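(* Let $V$ be an $\mathfrak{S}^0$-module such that the restriction of $V$ to a $U(\mathfrak{t})$-module is free of rank $1$, where $\mathfrak{t}=\mathbb{C}L_0\oplus\mathbb{C}W_0\oplus\mathbb{C}G_0$. Then, up to a parity-change (that is, for $V$ or for $\Pi(V)$), we have $V\cong\Omega_{\mathfrak{S}^0}(\lambda,\alpha,h)$ for some $\lambda\in\mathbb{C}^*$, $\alpha\in\mathbb{C}$, $h(t)\in\mathbb{C}[t]$.
   Context: All vector spaces are over $\mathbb{C}$. The Ramond type super-BMS$_3$ algebra $\mathfrak{S}^0$ is the Lie superalgebra with basis $\{L_m,W_m,G_m,C_1,C_2\mid m\in\mathbb{Z}\}$, where $L_m,W_m,C_1,C_2$ are even, the $G_m$ are odd, $C_1,C_2$ are central, and the non-trivial brackets are $$[L_m,L_n]=(n-m)L_{m+n}+\tfrac{n^3-n}{12}\delta_{m+n,0}C_1,\quad [L_m,W_n]=(n-m)W_{m+n}+\tfrac{n^3-n}{12}\delta_{m+n,0}C_2,$$ $$[L_m,G_r]=(r-\tfrac m2)G_{m+r},\quad [G_r,G_s]=2W_{r+s}+\tfrac13(r^2-\tfrac14)\delta_{r+s,0}C_2.$$ Modules over a Lie superalgebra are $\mathbb{Z}_2$-graded, with $x(yv)-(-1)^{|x||y|}y(xv)=[x,y]v$ for homogeneous $x,y$. $\Pi$ is the parity-change functor, interchanging the even and odd parts of a module. $\mathfrak{t}$ is taken modulo the center, so $G_0^2=W_0$ and $U(\mathfrak{t})=\mathbb{C}[L_0,W_0]\oplus G_0\mathbb{C}[L_0,W_0]$.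 Being free of rank $1$ over $U(\mathfrak{t})$ means that there is a homogeneous element $v$ such that every element can be written uniquely as $p(L_0,W_0)v+G_0q(L_0,W_0)v$ with $p,q$ polynomials. For $h(t)\in\mathbb{C}[t]$, $\alpha\in\mathbb{C}$ and $m\in\mathbb{Z}$, $h_m(t)=m\,h(t)-m(m-1)\alpha\,\frac{h(t)-h(\alpha)}{t-\alpha}\in\mathbb{C}[t]$. For $\lambda\in\mathbb{C}^*$, $\alpha\in\mathbb{C}$, $h\in\mathbb{C}[t]$, $\Omega_{\mathfrak{S}^0}(\lambda,\alpha,h)$ is the $\mathfrak{S}^0$-module with underlying space $\mathbb{C}[t^2,s]\oplus t\,\mathbb{C}[t^2,s]$, even part $\mathbb{C}[t^2,s]$, odd part $t\,\mathbb{C}[t^2,s]$, and action (for $m\in\mathbb{Z}$, $f(t^2,s)\in\mathbb{C}[t^2,s]$; $\frac{\partial}{\partial t^2}$ is the partial derivative with respect to the variable $t^2$) $$L_m f(t^2,s)=\lambda^m(s+h_m(t^2))f(t^2,s-m)-m\lambda^m(t^2-m\alpha)\tfrac{\partial}{\partial t^2}(f(t^2,s-m)),$$ $$L_m\, tf(t^2,s)=\lambda^m(s-\tfrac m2+h_m(t^2))tf(t^2,s-m)-m\lambda^m(t^2-m\alpha)t\tfrac{\partial}{\partial t^2}f(t^2,s-m),$$ $$W_m f(t^2,s)=\lambda^m(t^2-m\alpha)f(t^2,s-m),\quad W_m\, tf(t^2,s)=\lambda^m(t^2-m\alpha)tf(t^2,s-m),$$ $$G_m f(t^2,s)=\lambda^m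 tf(t^2,s-m),\quad G_m\, tf(t^2,s)=\lambda^m(t^2-2m\alpha)f(t^2,s-m),$$ with $C_1,C_2$ acting as $0$. *)

theory Defs
  imports Complex_Main "HOL-Library.Poly_Mapping" "HOL-Library.Product_Plus"
    "HOL-Computational_Algebra.Polynomial"
begin

text \<open>
  A parity is a boolean: \<open>False\<close> is even and \<open>True\<close> is odd, so the sum of parities is \<open>p \<noteq> q\<close>.
  The carrier of every space is the full type.
\<close>

record 'v super_space =
  scal :: "complex \<Rightarrow> 'v \<Rightarrow> 'v"
  part :: "bool \<Rightarrow> 'v set"

record 'g lie_superalgebra = "'g super_space" +
  bracket :: "'g \<Rightarrow> 'g \<Rightarrow> 'g"

record ('g, 'v) super_module = "'v super_space" +
  act :: "'g \<Rightarrow> 'v \<Rightarrow> 'v"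

definition is_super_space :: "('v::ab_group_add, 'z) super_space_scheme \<Rightarrow> bool" where
  "is_super_space V \<longleftrightarrow>
     vector_space (scal V) \<and>
     (\<forall>p. module.subspace (scal V) (part V p)) \<and>
     part V False \<inter> part V True = {0} \<and>
     (\<forall>v. \<exists>a \<in> part V False. \<exists>b \<in> part V True. v = a + b)"

definition koszul_sign :: "bool \<Rightarrow> bool \<Rightarrow> complex" where
  "koszul_sign p q = (if p \<and> q then - 1 else 1)"

definition is_super_module ::
  "'g::ab_group_add lie_superalgebra \<Rightarrow> ('g, 'v::ab_group_add) super_module \<Rightarrow> bool" where
  "is_super_module S V \<longleftrightarrow>
     is_super_space V \<and>
     (\<forall>v. Vector_Spaces.linear (scal S) (scal V) (\<lambda>x. act V x v)) \<and>
     (\<forall>x. Vector_Spaces.linear (scal V) (scal V) (act V x)) \<and>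
     (\<forall>p q. \<forall>x \<in> part S p. \<forall>v \<in> part V q. act V x v \<in> part V (p \<noteq> q)) \<and>
     (\<forall>p q. \<forall>x \<in> part S p. \<forall>y \<in> part S q. \<forall>v.
        act V x (act V y v) - scal V (koszul_sign p q) (act V y (act V x v))
          = act V (bracket S x y) v)"

definition module_iso ::
  "('g, 'v::ab_group_add) super_module \<Rightarrow> ('g, 'w::ab_group_add) super_module \<Rightarrow> bool" where
  "module_iso V M \<longleftrightarrow>
     (\<exists>\<phi>. Vector_Spaces.linear (scal V) (scal M) \<phi> \<and> bij \<phi> \<and>
          (\<forall>p. \<phi> ` part V p = part M p) \<and>
          (\<forall>x v. \<phi> (act V x v) = act M x (\<phi> v)))"

definition parity_change :: "('g, 'v) super_module \<Rightarrow> ('g, 'v) super_module" where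
  "parity_change V = V\<lparr>part := \<lambda>p. part V (\<not> p)\<rparr>"


subsection \<open>The Ramond type super-BMS algebra\<close>

datatype bms_gen = L int | W int | G int | C1 | C2

text \<open>The free vector space on the generators.\<close>

type_synonym bms = "bms_gen \<Rightarrow>\<^sub>0 complex"

fun odd_gen :: "bms_gen \<Rightarrow> bool" where
  "odd_gen (G r) = True"
| "odd_gen _ = False"

definition bms_scal :: "complex \<Rightarrow> bms \<Rightarrow> bms" where
  "bms_scal c = Poly_Mapping.map ((*) c)"

abbreviation gterm :: "complex \<Rightarrow> bms_gen \<Rightarrow> bms" where
  "gterm c b \<equiv> Poly_Mapping.single b c"

definition cocycle_coeff :: "int \<Rightarrow> complex" where
  "cocycle_coeff n = (of_int n ^ 3 - of_int n) / 12"

fun gen_bracket :: "bms_gen \<Rightarrow> bms_gen \<Rightarrow> bms" where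
  "gen_bracket (L m) (L n) =
     gterm (of_int (n - m)) (L (m + n)) + gterm (if m + n = 0 then cocycle_coeff n else 0) C1"
| "gen_bracket (L m) (W n) =
     gterm (of_int (n - m)) (W (m + n)) + gterm (if m + n = 0 then cocycle_coeff n else 0) C2"
| "gen_bracket (W n) (L m) =
     - (gterm (of_int (n - m)) (W (m + n)) + gterm (if m + n = 0 then cocycle_coeff n else 0) C2)"
| "gen_bracket (L m) (G r) = gterm (of_int r - of_int m / 2) (G (m + r))"
| "gen_bracket (G r) (L m) = - gterm (of_int r - of_int m / 2) (G (m + r))"
| "gen_bracket (G r) (G s) =
     gterm 2 (W (r + s)) + gterm (if r + s = 0 then (of_int r ^ 2 - 1 / 4) / 3 else 0) C2"
| "gen_bracket _ _ = 0"

definition bms_bracket :: "bms \<Rightarrow> bms \<Rightarrow> bms" where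
  "bms_bracket x y =
     (\<Sum>a \<in> Poly_Mapping.keys x. \<Sum>b \<in> Poly_Mapping.keys y.
        bms_scal (Poly_Mapping.lookup x a * Poly_Mapping.lookup y b) (gen_bracket a b))"

definition ramond_bms :: "bms lie_superalgebra" where
  "ramond_bms =
     \<lparr>scal = bms_scal,
      part = (\<lambda>p. {x. \<forall>b \<in> Poly_Mapping.keys x. odd_gen b = p}),
      bracket = bms_bracket\<rparr>"


subsection \<open>Freeness of rank one over the span of \<open>L\<^sub>0\<close>, \<open>W\<^sub>0\<close>, \<open>G\<^sub>0\<close>\<close>

text \<open>
  An element of \<open>\<complex>[x, s]\<close> is a polynomial in \<open>s\<close> (outer variable) whose coefficients are
  polynomials in \<open>x\<close> (inner variable).
\<close>

type_synonym poly2 = "complex poly poly"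

abbreviation gen_act :: "(bms, 'v) super_module \<Rightarrow> bms_gen \<Rightarrow> 'v \<Rightarrow> 'v" where
  "gen_act V b \<equiv> act V (gterm 1 b)"

text \<open>\<open>p(L\<^sub>0, W\<^sub>0) v\<close>, with \<open>s\<close> replaced by \<open>L\<^sub>0\<close> and \<open>x\<close> by \<open>W\<^sub>0\<close>.\<close>

definition poly2_act :: "(bms, 'v::ab_group_add) super_module \<Rightarrow> poly2 \<Rightarrow> 'v \<Rightarrow> 'v" where
  "poly2_act V p v =
     (\<Sum>i\<le>degree p. \<Sum>j\<le>degree (coeff p i).
        scal V (coeff (coeff p i) j) ((gen_act V (L 0) ^^ i) ((gen_act V (W 0) ^^ j) v)))"

definition free_rank_one_t :: "(bms, 'v::ab_group_add) super_module \<Rightarrow> bool" where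
  "free_rank_one_t V \<longleftrightarrow>
     (\<exists>v. (\<exists>p. v \<in> part V p) \<and>
          (\<forall>u. \<exists>!(p, q). u = poly2_act V p v + gen_act V (G 0) (poly2_act V q v)))"


subsection \<open>The modules \<open>\<Omega>(\<lambda>, \<alpha>, h)\<close>\<close>

text \<open>The division is exact.\<close>

definition h_sub :: "complex \<Rightarrow> complex poly \<Rightarrow> int \<Rightarrow> complex poly" where
  "h_sub \<alpha> h m =
     smult (of_int m) h
     - smult (of_int (m * (m - 1)) * \<alpha>) ((h - [:poly h \<alpha>:]) div [:- \<alpha>, 1:])"

definition cscale :: "complex \<Rightarrow> poly2 \<Rightarrow> poly2" where
  "cscale c f = smult [:c:] f"

text \<open>\<open>f(x, s) \<mapsto> f(x, s - m)\<close>\<close>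

definition s_shift :: "int \<Rightarrow> poly2 \<Rightarrow> poly2" where
  "s_shift m f = pcompose f [:[:- of_int m:], 1:]"

definition deriv_x :: "poly2 \<Rightarrow> poly2" where
  "deriv_x f = map_poly pderiv f"

text \<open>
  The pair \<open>(f, g)\<close> stands for \<open>f(t\<^sup>2, s) + t g(t\<^sup>2, s)\<close>; the inner variable \<open>x\<close> is \<open>t\<^sup>2\<close>.
  Hence \<open>[:a, 1:] :: poly2\<close> is \<open>s + a(t\<^sup>2)\<close>, and \<open>[:- (m\<alpha>), 1:] :: complex poly\<close> is \<open>t\<^sup>2 - m\<alpha>\<close>.
\<close>

fun omega_gen ::
  "complex \<Rightarrow> complex \<Rightarrow> complex poly \<Rightarrow> bms_gen \<Rightarrow> poly2 \<times> poly2 \<Rightarrow> poly2 \<times> poly2" where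
  "omega_gen l \<alpha> h (L m) (f, g) =
     (cscale (l powi m)
        ([:h_sub \<alpha> h m, 1:] * s_shift m f
         - smult (smult (of_int m) [:- (of_int m * \<alpha>), 1:]) (deriv_x (s_shift m f))),
      cscale (l powi m)
        ([:h_sub \<alpha> h m - [:of_int m / 2:], 1:] * s_shift m g
         - smult (smult (of_int m) [:- (of_int m * \<alpha>), 1:]) (deriv_x (s_shift m g))))"
| "omega_gen l \<alpha> h (W m) (f, g) =
     (cscale (l powi m) (smult [:- (of_int m * \<alpha>), 1:] (s_shift m f)),
      cscale (l powi m) (smult [:- (of_int m * \<alpha>), 1:] (s_shift m g)))"
| "omega_gen l \<alpha> h (G m) (f, g) =
     (cscale (l powi m) (smult [:- (2 * of_int m * \<alpha>), 1:] (s_shift m g)),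
      cscale (l powi m) (s_shift m f))"
| "omega_gen l \<alpha> h C1 (f, g) = (0, 0)"
| "omega_gen l \<alpha> h C2 (f, g) = (0, 0)"

definition pair_scale :: "complex \<Rightarrow> poly2 \<times> poly2 \<Rightarrow> poly2 \<times> poly2" where
  "pair_scale c = map_prod (cscale c) (cscale c)"

definition omega :: "complex \<Rightarrow> complex \<Rightarrow> complex poly \<Rightarrow> (bms, poly2 \<times> poly2) super_module" where
  "omega l \<alpha> h =
     \<lparr>scal = pair_scale,
      part = (\<lambda>p. if p then {0} \<times> UNIV else UNIV \<times> {0}),
      act = (\<lambda>x v. \<Sum>b \<in> Poly_Mapping.keys x.
               pair_scale (Poly_Mapping.lookup x b) (omega_gen l \<alpha> h b v))\<rparr>"

end

theory Submission
  imports Defs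
begin

text \<open>
  Let \<open>v\<close> be a homogeneous generator; after a parity change it is even. The even part of \<open>V\<close> is then
  \<open>P f = f(L\<^sub>0, W\<^sub>0) v\<close> and the odd part is \<open>Q f = G\<^sub>0 (P f)\<close>, with \<open>f\<close> running through \<open>\<complex>[x, s]\<close>. The brackets
  with \<open>L\<^sub>0\<close> and \<open>W\<^sub>0\<close> move every generator past polynomials in \<open>L\<^sub>0\<close> and \<open>W\<^sub>0\<close>: it shifts \<open>s\<close> by \<open>m\<close>, and
  \<open>L\<^sub>m\<close> in addition differentiates in \<open>x\<close>. So the whole module structure is encoded by the polynomials
  defined by \<open>W\<^sub>m v = P (a m)\<close>, \<open>L\<^sub>m v = P (b m)\<close>, \<open>G\<^sub>m v = Q (g m)\<close>, \<open>C\<^sub>1 v = P c1\<close> and \<open>C\<^sub>2 v = P c2\<close>, and the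
  bracket relations turn into polynomial identities between them.

  The identities are solved in the following way.

  \<^item> No \<open>a m\<close> vanishes, because \<open>W\<^sub>m = 0\<close> would force \<open>W\<^sub>1 = 0\<close> and then \<open>W\<^sub>0 = 0\<close>. Commutation of \<open>W\<^sub>m\<close> with
    \<open>W\<^bsub>-m\<^esub>\<close> makes \<open>a m (s) \<cdot> a (-m) (s - m)\<close> periodic in \<open>s\<close>, hence constant in \<open>s\<close>; so \<open>a m\<close> depends on
    \<open>x\<close> only. Then central elements act by scalars, and \<open>[L\<^sub>m, W\<^sub>1]\<close> shows that \<open>b m\<close> is linear in \<open>s\<close>.

  \<^item> \<open>[L\<^sub>m, W\<^sub>m] = 0\<close> says that the coefficient of \<open>s\<close> in \<open>b m\<close> is the derivative of \<open>a m\<close>. This turns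
    \<open>[L\<^sub>m, W\<^sub>n]\<close> into a Witt-type relation for the \<open>a m\<close> alone. A degree count leaves only
    \<open>a m\<close> of degree 1, and comparing coefficients gives \<open>a m = \<lambda>\<^sup>m (x - m \<alpha>)\<close> and \<open>c2 = 0\<close>
    (lemmas \<open>degree_A\<close>, \<open>lam_powi\<close>, \<open>nu_linear\<close>).

  \<^item> The constant coefficients of \<open>b m\<close>, divided by \<open>\<lambda>\<^sup>m\<close>, satisfy a linear system that is also solved by
    \<open>h_sub \<alpha> h m\<close> with \<open>h\<close> the constant coefficient at \<open>m = 1\<close>. The difference of the two solutions
    vanishes at \<open>m = 1\<close>, and this forces it, together with \<open>c1\<close>, to vanish (lemma \<open>h_sub_unique\<close>).

  \<^item> Since \<open>C\<^sub>2\<close> acts by 0, \<open>G\<^sub>m\<^sup>2 = W\<^bsub>2m\<^esub>\<close>, which becomes a quadratic equation for \<open>g m\<close> with the double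
    root \<open>\<lambda>\<^sup>m\<close> (lemma \<open>odd_structure_constant\<close>).

  With these values \<open>(f, g) \<mapsto> P f + Q g\<close> is an isomorphism from \<open>\<Omega>(\<lambda>, \<alpha>, h)\<close> onto \<open>V\<close>.
\<close>

section \<open>Shift and derivative on polynomials in two variables\<close>

abbreviation X :: poly2 where "X \<equiv> [:[:0, 1:]:]"
abbreviation S :: poly2 where "S \<equiv> [:0, 1:]"

lemma s_shift_add: "s_shift m (f + g) = s_shift m f + s_shift m g"
  and s_shift_diff: "s_shift m (f - g) = s_shift m f - s_shift m g"
  and s_shift_mult: "s_shift m (f * g) = s_shift m f * s_shift m g"
  and s_shift_const: "s_shift m [:c:] = [:c:]"
  and s_shift_1: "s_shift m 1 = 1"
  and s_shift_0: "s_shift m 0 = 0"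
  and s_shift_linear: "s_shift m [:d, c:] = [:d - of_int m * c, c:]"
  by (simp_all add: s_shift_def pcompose_add pcompose_diff pcompose_mult pcompose_pCons pcompose_1
      of_int_poly)

lemma degree_s_shift: "degree (s_shift m f) = degree f"
  by (simp add: s_shift_def degree_pcompose)

lemma s_shift_eq_0_iff: "s_shift m f = 0 \<longleftrightarrow> f = 0"
  by (simp add: s_shift_def pcompose_eq_0_iff)

lemma s_shift_cscale: "s_shift m (cscale c f) = cscale c (s_shift m f)"
  by (simp add: s_shift_def cscale_def pcompose_smult)

lemma s_shift_inverse: "s_shift (- m) (s_shift m f) = f"
  by (simp add: s_shift_def pcompose_assoc[symmetric] pcompose_pCons pcompose_idR)

lemma s_shift_zero_shift: "s_shift 0 f = f"
  by (simp add: s_shift_def pcompose_idR)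

lemma coeff_deriv_x: "coeff (deriv_x f) i = pderiv (coeff f i)"
  by (simp add: deriv_x_def coeff_map_poly)

lemma deriv_x_add: "deriv_x (f + g) = deriv_x f + deriv_x g"
  by (simp add: poly_eq_iff coeff_deriv_x pderiv_add)

lemma deriv_x_diff: "deriv_x (f - g) = deriv_x f - deriv_x g"
  by (simp add: poly_eq_iff coeff_deriv_x pderiv_diff)

lemma deriv_x_pCons: "deriv_x (pCons c f) = pCons (pderiv c) (deriv_x f)"
  by (rule poly_eqI) (simp add: coeff_deriv_x coeff_pCons split: nat.split)

lemma deriv_x_0: "deriv_x 0 = 0"
  by (simp add: deriv_x_def)

lemma deriv_x_1: "deriv_x 1 = 0"
  by (simp add: one_pCons deriv_x_pCons deriv_x_0)

lemma deriv_x_smult: "deriv_x (smult c f) = smult (pderiv c) f + smult c (deriv_x f)"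
  by (rule poly_eqI) (simp add: coeff_deriv_x pderiv_mult algebra_simps)

lemma deriv_x_cscale: "deriv_x (cscale c f) = cscale c (deriv_x f)"
  by (simp add: cscale_def deriv_x_smult pderiv_pCons)

lemma cscale_eq_mult: "cscale c f = [:[:c:]:] * f"
  by (simp add: cscale_def)

lemma of_int_poly2: "(of_int m :: poly2) = [:of_int m:]"
  by (simp add: of_int_poly)

lemma cscale_of_int: "cscale (of_int m) f = of_int m * f"
  by (simp add: cscale_eq_mult of_int_poly)

text \<open>
  Every operator below is known on \<open>v\<close> and has a commutation rule with \<open>W\<^sub>0\<close> and \<open>L\<^sub>0\<close>, which act as
  multiplication by \<open>X\<close> and by \<open>S\<close>; this rule of induction follows exactly that information.
\<close>
lemma poly2_induct [case_names one add cscale X S]: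
  assumes "Q 1" "\<And>f g. Q f \<Longrightarrow> Q g \<Longrightarrow> Q (f + g)" "\<And>c f. Q f \<Longrightarrow> Q (cscale c f)"
    "\<And>f. Q f \<Longrightarrow> Q (X * f)" "\<And>f. Q f \<Longrightarrow> Q (S * f)"
  shows "Q f"
proof -
  have zero: "Q 0"
    using assms(3)[OF assms(1), of 0] by (simp add: cscale_def)
  have inner: "Q [:c:]" for c
  proof (induction c)
    case 0
    then show ?case using zero by simp
  next
    case (pCons k c)
    have "[:pCons k c:] = cscale k 1 + X * [:c:]"
      by (simp add: cscale_def)
    then show ?case
      using assms pCons.IH by metis
  qed
  show ?thesis
  proof (induction f)
    case 0
    then show ?case by (rule zero)
  next
    case (pCons c f)
    have "pCons c f = [:c:] + S * f" by simp
    then show ?case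
      using assms(2)[OF inner[of c] assms(5)[OF pCons.IH]] by (simp only:)
  qed
qed

text \<open>A polynomial with period \<open>m \<noteq> 0\<close> takes its value at 0 on the infinite set of multiples of \<open>m\<close>.\<close>
lemma periodic_imp_const:
  assumes "s_shift m f = f" "m \<noteq> 0"
  obtains c where "f = [:c:]"
proof -
  have step: "poly f (z - of_int m) = poly f z" for z
  proof -
    have "poly f z = poly (s_shift m f) z" using assms(1) by simp
    also have "\<dots> = poly f (z - of_int m)"
      by (simp add: s_shift_def poly_pcompose)
        (metis (no_types) diff_conv_add_uminus minus_pCons add.commute of_int_poly of_int_minus)
    finally show ?thesis by simp
  qed
  have "poly f (- of_nat k * of_int m) = poly f 0" for k
    by (induction k) (use step in \<open>auto simp: algebra_simps\<close>, metis step diff_conv_add_uminus add.commute)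
  then have "(\<lambda>k. - of_nat k * of_int m) ` (UNIV :: nat set) \<subseteq> {z. poly (f - [:poly f 0:]) z = 0}"
    by auto
  moreover have "inj (\<lambda>k. - of_nat k * of_int m :: complex poly)"
    using assms(2) by (auto simp: inj_on_def)
  ultimately have "infinite {z. poly (f - [:poly f 0:]) z = 0}"
    using finite_subset finite_imageD infinite_UNIV_nat by blast
  then have "f - [:poly f 0:] = 0"
    using poly_roots_finite by blast
  then show ?thesis using that by (metis eq_iff_diff_eq_0)
qed

text \<open>
  If \<open>f(s) - f(s - m) = k\<close>, then \<open>m f - k s\<close> has period \<open>m\<close> and is therefore constant.
\<close>
lemma difference_const_imp_linear:
  assumes "f - s_shift m f = [:k:]" "m \<noteq> 0"
  obtains d c where "f = [:d, c:]"
proof -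
  define F where "F = of_int m * f - [:0, k:]"
  have "s_shift m f = f - [:k:]" using assms(1) by (simp add: algebra_simps)
  then have "s_shift m F = of_int m * (f - [:k:]) - [:0 - of_int m * k, k:]"
    unfolding F_def s_shift_diff s_shift_mult s_shift_linear of_int_poly2 s_shift_const by simp
  also have "\<dots> = F"
    by (simp add: F_def algebra_simps of_int_poly2 smult_diff_right)
  finally have "s_shift m F = F" .
  then obtain e where "F = [:e:]"
    using periodic_imp_const assms(2) by blast
  then have eq: "of_int m * f = [:e, k:]"
    by (simp add: F_def algebra_simps)
  have "degree f = degree (of_int m * f)"
    using assms(2) by (simp add: of_int_poly2)
  also have "\<dots> \<le> 1" by (simp add: eq)
  finally have "degree f \<le> 1" .
  then have "f = [:coeff f 0, coeff f 1:]"
    by (intro poly_eqI) (auto simp: coeff_pCons coeff_eq_0 split: nat.split)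
  then show ?thesis using that by blast
qed

section \<open>The linear system solved by \<open>h_sub\<close>\<close>

lemma pderiv_of_int: "pderiv (of_int m :: complex poly) = 0"
  by (simp add: of_int_poly)

text \<open>
  Writing \<open>h = (x - \<alpha>) q + c\<close> with \<open>c = h(\<alpha>)\<close> gives \<open>m h - m (m - 1) \<alpha> q = m ((x - m \<alpha>) q + c)\<close>, a form in
  which the relations can be checked by ring arithmetic.
\<close>
lemma h_sub_eq:
  obtains q c where "\<And>m. h_sub \<alpha> h m = of_int m * ([:- (of_int m * \<alpha>), 1:] * q + [:c:])"
proof -
  define c where "c = poly h \<alpha>"
  define q where "q = (h - [:c:]) div [:- \<alpha>, 1:]"
  have "[:- \<alpha>, 1:] dvd h - [:c:]"
    by (simp add: c_def flip: poly_eq_0_iff_dvd)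
  then have h: "h = [:- \<alpha>, 1:] * q + [:c:]"
    unfolding q_def by (metis dvd_mult_div_cancel diff_add_cancel)
  have "h_sub \<alpha> h m = of_int m * ([:- (of_int m * \<alpha>), 1:] * q + [:c:])" for m
  proof -
    have "h_sub \<alpha> h m = smult (of_int m) h - smult (of_int (m * (m - 1)) * \<alpha>) q"
      by (simp add: h_sub_def q_def c_def)
    also have "\<dots> = of_int m * ([:- (of_int m * \<alpha>), 1:] * q + [:c:])"
      by (rule poly_eqI) (simp add: h of_int_poly coeff_pCons algebra_simps split: nat.split)
    finally show ?thesis .
  qed
  then show ?thesis using that by blast
qed

lemma h_sub_1: "h_sub \<alpha> h 1 = h"
  by (simp add: h_sub_def)

lemma h_sub_0: "h_sub \<alpha> h 0 = 0"
  by (simp add: h_sub_def)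

text \<open>
  This is the constant coefficient in \<open>s\<close> of the relation \<open>[L\<^sub>m, L\<^sub>n] = (n - m) L\<^bsub>m+n\<^esub>\<close> in \<open>\<Omega>(1, \<alpha>, h)\<close>.
\<close>
lemma h_sub_bracket_relation:
  "of_int n * h_sub \<alpha> h n - of_int m * h_sub \<alpha> h m
     + of_int n * [:- (of_int n * \<alpha>), 1:] * pderiv (h_sub \<alpha> h m)
     - of_int m * [:- (of_int m * \<alpha>), 1:] * pderiv (h_sub \<alpha> h n)
   = of_int (n - m) * h_sub \<alpha> h (m + n)"
proof -
  obtain q c where eq: "\<And>m. h_sub \<alpha> h m = of_int m * ([:- (of_int m * \<alpha>), 1:] * q + [:c:])"
    using h_sub_eq[where h = h and \<alpha> = \<alpha>] by blast
  define x :: "complex poly" where "x = [:0, 1:]"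
  define k :: "complex poly" where "k = [:c:]"
  define e :: "complex poly" where "e = [:\<alpha>:]"
  have lin: "[:- (of_int m * \<alpha>), 1:] = x - of_int m * e" for m
    by (simp add: x_def e_def of_int_poly)
  have pd0: "pderiv x = 1" "pderiv k = 0" "pderiv e = 0"
    by (simp_all add: x_def e_def k_def pderiv_pCons)
  have pd: "pderiv (of_int m * ((x - of_int m * e) * q + k)) = of_int m * (q + (x - of_int m * e) * pderiv q)" for m
    by (simp add: pderiv_mult pderiv_diff pderiv_add pderiv_of_int pd0 algebra_simps)
  show ?thesis
    unfolding eq lin k_def[symmetric] pd by (simp add: algebra_simps)
qed

text \<open>
  On a polynomial of degree \<open>n\<close> the operator multiplies the leading coefficient by \<open>n + k > 0\<close>.
\<close>
lemma first_order_ode_zero: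
  fixes p :: "complex poly"
  assumes "[:u, 1:] * pderiv p + of_nat k * p = 0" "k > 0"
  shows "p = 0"
proof -
  have "coeff ([:u, 1:] * pderiv p + of_nat k * p) (degree p) = of_nat (degree p + k) * lead_coeff p"
    by (cases "degree p")
       (auto simp: coeff_pderiv coeff_pCons coeff_eq_0 of_nat_poly algebra_simps)
  then have "of_nat (degree p + k) * lead_coeff p = 0"
    unfolding assms(1) by simp
  then show ?thesis using assms(2) by (simp only: mult_eq_0_iff of_nat_eq_0_iff) auto
qed

text \<open>
  The difference \<open>E m = d m - h_sub \<alpha> (d 1) m\<close> solves the same linear system, with \<open>E 0 = E 1 = 0\<close>. The
  relations for \<open>(-1, 1)\<close>, \<open>(2, -1)\<close> and \<open>(-2, 1)\<close> are then differential equations without nonzero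
  polynomial solution for \<open>E (-1)\<close>, \<open>E 2\<close> and \<open>E (-2)\<close>. The relation for \<open>(2, -2)\<close>, where the
  cocycle is \<open>1/2\<close>, gives \<open>z = 0\<close>, and brackets with the indices \<open>1\<close> and \<open>-1\<close> reach all other \<open>m\<close>.
\<close>
lemma h_sub_unique:
  fixes d :: "int \<Rightarrow> complex poly"
  assumes "d 0 = 0"
    and rel: "\<And>n m. of_int n * d n - of_int m * d m
     + of_int n * [:- (of_int n * \<alpha>), 1:] * pderiv (d m)
     - of_int m * [:- (of_int m * \<alpha>), 1:] * pderiv (d n)
   = of_int (n - m) * d (m + n) + [:(if m + n = 0 then cocycle_coeff n else 0) * z:]"
  shows "z = 0" "d m = h_sub \<alpha> (d 1) m"
proof -
  define E where "E m = d m - h_sub \<alpha> (d 1) m" for m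
  have E: "of_int n * E n - of_int m * E m
     + of_int n * [:- (of_int n * \<alpha>), 1:] * pderiv (E m)
     - of_int m * [:- (of_int m * \<alpha>), 1:] * pderiv (E n)
   = of_int (n - m) * E (m + n) + [:(if m + n = 0 then cocycle_coeff n else 0) * z:]" for n m
  proof -
    have distribute: "r * (u - u') - s * (w - w') + t * (v - v') - t' * (y - y')
        = (r * u - s * w + t * v - t' * y) - (r * u' - s * w' + t * v' - t' * y')"
      for r s t t' u u' v v' w w' y y' :: "complex poly"
      by (simp add: algebra_simps)
    show ?thesis
      unfolding E_def pderiv_diff distribute rel h_sub_bracket_relation
      by (simp add: right_diff_distrib)
  qed
  have E0: "E 0 = 0" and E1: "E 1 = 0"
    by (simp_all add: E_def assms(1) h_sub_0 h_sub_1)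
  have "[:- \<alpha>, 1:] * pderiv (E (-1)) + of_nat 1 * E (-1)
     = - (of_int (-1) * E (-1) - of_int 1 * E 1
       + of_int (-1) * [:- (of_int (-1) * \<alpha>), 1:] * pderiv (E 1)
       - of_int 1 * [:- (of_int 1 * \<alpha>), 1:] * pderiv (E (-1)))"
    by (simp add: E1)
  also have "\<dots> = 0"
    unfolding E by (simp add: E0 cocycle_coeff_def)
  finally have "[:- \<alpha>, 1:] * pderiv (E (-1)) + of_nat 1 * E (-1) = 0" .
  then have Em1: "E (-1) = 0" by (rule first_order_ode_zero) simp
  have "[:\<alpha>, 1:] * pderiv (E 2) + of_nat 2 * E 2
     = of_int 2 * E 2 - of_int (-1) * E (-1)
       + of_int 2 * [:- (of_int 2 * \<alpha>), 1:] * pderiv (E (-1))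
       - of_int (-1) * [:- (of_int (-1) * \<alpha>), 1:] * pderiv (E 2)"
    by (simp add: Em1)
  also have "\<dots> = 0"
    unfolding E by (simp add: E1)
  finally have "[:\<alpha>, 1:] * pderiv (E 2) + of_nat 2 * E 2 = 0" .
  then have E2: "E 2 = 0" by (rule first_order_ode_zero) simp
  have "[:- \<alpha>, 1:] * pderiv (E (-2)) + of_nat 2 * E (-2)
     = - (of_int (-2) * E (-2) - of_int 1 * E 1
       + of_int (-2) * [:- (of_int (-2) * \<alpha>), 1:] * pderiv (E 1)
       - of_int 1 * [:- (of_int 1 * \<alpha>), 1:] * pderiv (E (-2)))"
    by (simp add: E1)
  also have "\<dots> = 0"
    unfolding E by (simp add: Em1)
  finally have "[:- \<alpha>, 1:] * pderiv (E (-2)) + of_nat 2 * E (-2) = 0" .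
  then have Em2: "E (-2) = 0" by (rule first_order_ode_zero) simp
  show z: "z = 0"
    using E[of 2 "-2"] by (simp add: E0 E2 Em2 cocycle_coeff_def)
  have nonneg: "E (int k) = 0" for k
  proof (induction k)
    case (Suc k)
    have "of_int (int k - 1) * E (int (Suc k)) = 0"
      using E[of "int k" 1] by (simp add: Suc E1 z add.commute)
    then show ?case using E2
      by (cases "k = 1") (auto simp only: mult_eq_0_iff of_int_eq_0_iff, simp_all)
  qed (simp add: E0)
  have neg: "E (- int k) = 0" for k
  proof (induction k)
    case (Suc k)
    have "of_int (- int k + 1) * E (- int (Suc k)) = 0"
      using E[of "- int k" "-1"] by (simp add: Suc Em1 z algebra_simps)
    then show ?case using Em2
      by (cases "k = 1") (auto simp only: mult_eq_0_iff of_int_eq_0_iff, simp_all)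
  qed (simp add: E0)
  have "E m = 0"
    using nonneg[of "nat m"] neg[of "nat (- m)"] by (cases "m \<ge> 0") auto
  then show "d m = h_sub \<alpha> (d 1) m" by (simp add: E_def)
qed

section \<open>Solving the identities for the even structure constants\<close>

text \<open>
  The hypotheses are what the bracket relations say about \<open>W\<^sub>m v\<close>, \<open>L\<^sub>m v\<close>, \<open>C\<^sub>1 v\<close> and \<open>C\<^sub>2 v\<close>: they
  come from evaluating at \<open>v\<close> the brackets \<open>[W\<^sub>m, W\<^sub>n]\<close>, \<open>[L\<^sub>m, W\<^sub>n]\<close>, \<open>[L\<^sub>m, L\<^sub>n]\<close> and the commutation of
  the central elements with \<open>W\<^sub>m\<close> and \<open>L\<^sub>m\<close>.
\<close>

locale structure_constants =
  fixes a b :: "int \<Rightarrow> poly2" and c1 c2 :: poly2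
  assumes a0: "a 0 = X"
    and WW: "a m * s_shift m (a n) = a n * s_shift n (a m)"
    and LW: "b m * s_shift m (a n) - of_int m * a m * deriv_x (s_shift m (a n)) - a n * s_shift n (b m)
      = of_int (n - m) * a (m + n) + cscale (if m + n = 0 then cocycle_coeff n else 0) c2"
    and LL: "(b m * s_shift m (b n) - of_int m * a m * deriv_x (s_shift m (b n)))
        - (b n * s_shift n (b m) - of_int n * a n * deriv_x (s_shift n (b m)))
      = of_int (n - m) * b (m + n) + cscale (if m + n = 0 then cocycle_coeff n else 0) c1"
    and WC1: "a m * s_shift m c1 = c1 * a m"
    and WC2: "a m * s_shift m c2 = c2 * a m"
    and LC1: "b m * s_shift m c1 - of_int m * a m * deriv_x (s_shift m c1) = c1 * b m"
    and LC2: "b m * s_shift m c2 - of_int m * a m * deriv_x (s_shift m c2) = c2 * b m"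
    and b0: "b 0 = S"
begin

lemma a_nonzero: "a m \<noteq> 0"
proof
  assume "a m = 0"
  \<comment> \<open>bracketing the zero operator \<open>W\<^sub>m\<close> with \<open>L\<^bsub>1-m\<^esub>\<close> gives \<open>2m - 1 \<noteq> 0\<close> times \<open>W\<^sub>1\<close>\<close>
  then have "of_int (2 * m - 1) * a 1 = 0"
    using LW[of "1 - m" m] by (simp add: s_shift_0 deriv_x_0 cscale_def)
  moreover have "2 * m - 1 \<noteq> 0" by presburger
  ultimately have "a 1 = 0" by (simp only: mult_eq_0_iff of_int_eq_0_iff) simp
  \<comment> \<open>the cocycle vanishes at 1, so \<open>[L\<^bsub>-1\<^esub>, W\<^sub>1] = 2 W\<^sub>0\<close> exactly\<close>
  then have "2 * X = 0"
    using LW[of "-1" 1] a0 by (simp add: s_shift_0 deriv_x_0 cscale_def cocycle_coeff_def)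
  then show False by (simp add: mult_2)
qed

text \<open>
  Put \<open>F(s) = a m (s) \<cdot> a (-m) (s - m)\<close>. Commutation of \<open>W\<^sub>m\<close> and \<open>W\<^bsub>-m\<^esub>\<close> says \<open>F(s + m) = F(s)\<close>, so \<open>F\<close>,
  and with it each of its factors, is constant in \<open>s\<close>.
\<close>
lemma a_const: "\<exists>A. a m = [:A:]"
proof (cases "m = 0")
  case True
  then show ?thesis using a0 by blast
next
  case False
  define F where "F = a m * s_shift m (a (- m))"
  have "s_shift (- m) F = s_shift (- m) (a m) * a (- m)"
    by (simp add: F_def s_shift_mult s_shift_inverse)
  also have "\<dots> = F"
    using WW[of m "-m"] by (simp add: F_def mult.commute)
  finally obtain c where "F = [:c:]"
    using periodic_imp_const False by (metis neg_0_equal_iff_equal)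
  moreover have "degree F = degree (a m) + degree (a (- m))"
    by (simp add: F_def degree_mult_eq a_nonzero s_shift_eq_0_iff degree_s_shift)
  ultimately have "degree (a m) = 0" by simp
  then show ?thesis by (metis degree_eq_zeroE)
qed

text \<open>
  A central element commutes with \<open>W\<^sub>1\<close>, so its polynomial has period 1 in \<open>s\<close>; it commutes with \<open>L\<^sub>1\<close>, so
  its derivative in \<open>x\<close> vanishes.
\<close>
lemma central_const:
  assumes W: "\<And>m. a m * s_shift m c = c * a m"
    and L: "\<And>m. b m * s_shift m c - of_int m * a m * deriv_x (s_shift m c) = c * b m"
  shows "\<exists>z. c = [:[:z:]:]"
proof -
  have "s_shift 1 c = c" using W[of 1] a_nonzero by simp
  then obtain k where k: "c = [:k:]" using periodic_imp_const by (metis zero_neq_one)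
  have "deriv_x c = 0" using L[of 1] a_nonzero[of 1] by (simp add: k s_shift_const)
  then have "pderiv k = 0" by (simp add: k deriv_x_pCons deriv_x_0)
  then show ?thesis using k by (metis pderiv_eq_0_iff degree_eq_zeroE)
qed

definition A :: "int \<Rightarrow> complex poly" where "A m = coeff (a m) 0"

lemma a_eq: "a m = [:A m:]"
  using a_const[of m] by (auto simp: A_def)

lemma A_nonzero: "A m \<noteq> 0"
  using a_nonzero[of m] a_eq[of m] by auto

lemma A_0: "A 0 = [:0, 1:]"
  by (simp add: A_def a0)

definition z1 :: complex where "z1 = coeff (coeff c1 0) 0"
definition z2 :: complex where "z2 = coeff (coeff c2 0) 0"

lemma c1_eq: "c1 = [:[:z1:]:]"
  using central_const[OF WC1 LC1] by (auto simp: z1_def)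

lemma c2_eq: "c2 = [:[:z2:]:]"
  using central_const[OF WC2 LC2] by (auto simp: z2_def)

text \<open>
  As rewrite rules \<open>c1_eq\<close> and \<open>c2_eq\<close> would loop, since \<open>z1\<close> abbreviates a term in \<open>c1\<close> and \<open>z2\<close> one in \<open>c2\<close>.
\<close>
lemma coeff_c1: "coeff c1 0 = [:z1:]"
  by (subst c1_eq) simp

lemma coeff_c2: "coeff c2 0 = [:z2:]"
  by (subst c2_eq) simp

text \<open>
  In \<open>[L\<^sub>m, W\<^sub>1]\<close> every term except \<open>a 1 \<cdot> (b m (s) - b m (s - 1))\<close> is constant in \<open>s\<close>.
\<close>
lemma b_linear: "\<exists>d c. b m = [:d, c:]"
proof -
  define F where "F = b m - s_shift 1 (b m)"
  have eq: "a 1 * F = of_int m * a m * deriv_x (s_shift m (a 1)) + of_int (1 - m) * a (m + 1)"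
    using LW[of m 1] unfolding F_def
    by (simp add: a_eq s_shift_const cocycle_coeff_def cscale_def algebra_simps)
  have "degree (a 1 * F) = 0"
    unfolding eq by (simp add: a_eq s_shift_const deriv_x_pCons deriv_x_0 of_int_poly2)
  then have "degree F = 0"
    using a_nonzero[of 1] by (cases "F = 0") (auto simp: degree_mult_eq)
  then obtain k where "F = [:k:]" by (metis degree_eq_zeroE)
  then show ?thesis using difference_const_imp_linear[of "b m" 1 k] F_def by (metis zero_neq_one)
qed

definition B :: "int \<Rightarrow> complex poly" where "B m = coeff (b m) 1"
definition D :: "int \<Rightarrow> complex poly" where "D m = coeff (b m) 0"

lemma b_eq: "b m = [:D m, B m:]"
  using b_linear[of m] by (auto simp: B_def D_def)

lemma B_0: "B 0 = 1" and D_0: "D 0 = 0"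
  by (simp_all add: B_def D_def b0)

lemma LW_coeff: "of_int n * A n * B m - of_int m * A m * pderiv (A n)
   = of_int (n - m) * A (m + n) + [:(if m + n = 0 then cocycle_coeff n else 0) * z2:]"
  using arg_cong[OF LW[of m n], of "\<lambda>f. coeff f 0"]
  by (simp add: a_eq b_eq coeff_c2 s_shift_linear s_shift_const coeff_deriv_x of_int_poly2
      coeff_mult_0 cscale_def algebra_simps)

lemma B_eq: "m \<noteq> 0 \<Longrightarrow> B m = pderiv (A m)"
  using LW_coeff[of m m] A_nonzero[of m] by (simp add: mult.assoc cocycle_coeff_def)

text \<open>
  The coefficient \<open>B m\<close> is determined by \<open>A m\<close>, which leaves a relation between the \<open>A m\<close> alone.
\<close>
lemma A_rel:
  assumes "m \<noteq> 0"
  shows "of_int n * A n * pderiv (A m) - of_int m * A m * pderiv (A n)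
   = of_int (n - m) * A (m + n) + [:(if m + n = 0 then cocycle_coeff n else 0) * z2:]"
  using LW_coeff[of n m] unfolding B_eq[OF assms] .

text \<open>For \<open>n = -m\<close> the relation gives the derivative of \<open>A m \<cdot> A (-m)\<close>, which has degree 1.\<close>
lemma degree_A_add:
  assumes "m \<noteq> 0"
  shows "degree (A m) + degree (A (- m)) = 2"
proof -
  have "of_int m * pderiv (A m * A (- m))
      = - (of_int (- m) * A (- m) * pderiv (A m) - of_int m * A m * pderiv (A (- m)))"
    by (simp add: pderiv_mult algebra_simps)
  also have "\<dots> = [: - (cocycle_coeff (-m) * z2), 2 * of_int m :]"
    unfolding A_rel[OF assms] by (simp add: A_0 of_int_poly)
  finally have "of_int m * pderiv (A m * A (- m)) = [: - (cocycle_coeff (-m) * z2), 2 * of_int m :]" .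
  then have "degree (of_int m * pderiv (A m * A (- m))) = 1"
    using assms by simp
  then have "degree (pderiv (A m * A (- m))) = 1"
    using assms by (simp add: of_int_poly)
  then have "degree (A m * A (- m)) = 2"
    by (simp add: degree_pderiv)
  then show ?thesis by (simp add: degree_mult_eq A_nonzero)
qed

text \<open>
  If \<open>A m\<close> were constant, then \<open>A (-m)\<close> would have degree 2, and the relation for \<open>m\<close> and \<open>-2m\<close> would make
  the derivative of \<open>A (-2m)\<close> a multiple of \<open>A (-m)\<close>. So \<open>A (-2m)\<close> would have degree 3, above the
  bound 2.
\<close>
lemma degree_A_nonzero:
  assumes "m \<noteq> 0"
  shows "degree (A m) \<noteq> 0"
proof
  assume "degree (A m) = 0"
  then obtain k where k: "A m = [:k:]" by (metis degree_eq_zeroE)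
  have "k \<noteq> 0" using A_nonzero[of m] k by auto
  have "smult (of_int m * k) (pderiv (A (-2 * m))) = smult (of_int (3 * m)) (A (- m))"
    using A_rel[OF assms, of "-2 * m"] assms by (simp add: k of_int_poly algebra_simps)
  then have "degree (pderiv (A (-2 * m))) = degree (A (- m))"
    using assms \<open>k \<noteq> 0\<close> 
    by (metis degree_smult_eq mult_eq_0_iff of_int_eq_0_iff zero_neq_numeral)
  also have "\<dots> = 2" using degree_A_add[OF assms] k by simp
  finally have "degree (A (-2 * m)) = 3" by (simp add: degree_pderiv)
  then show False using degree_A_add[of "-2 * m"] assms by simp
qed

lemma degree_A: "degree (A m) = 1"
proof (cases "m = 0")
  case False
  then show ?thesis
    using degree_A_add[of m] degree_A_nonzero[of m] degree_A_nonzero[of "-m"] by simp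
qed (simp add: A_0)

definition lam :: "int \<Rightarrow> complex" where "lam m = coeff (A m) 1"
definition mu :: "int \<Rightarrow> complex" where "mu m = coeff (A m) 0"

lemma A_eq: "A m = [:mu m, lam m:]"
  by (rule poly_eqI) (auto simp: lam_def mu_def coeff_pCons coeff_eq_0 degree_A split: nat.split)

lemma lam_nonzero: "lam m \<noteq> 0"
  using degree_A[of m] leading_coeff_0_iff[of "A m"] A_nonzero[of m] by (simp add: lam_def)

lemma lam_0: "lam 0 = 1" and mu_0: "mu 0 = 0"
  by (simp_all add: lam_def mu_def A_0)

lemma lam_add: "m \<noteq> n \<Longrightarrow> lam (m + n) = lam m * lam n"
proof (cases "m = 0")
  case False
  assume "m \<noteq> n"
  have "of_int (n - m) * (lam m * lam n) = of_int (n - m) * lam (m + n)"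
    using arg_cong[OF A_rel[OF False, of n], of "\<lambda>p. coeff p 1"]
    by (simp add: A_eq of_int_poly pderiv_pCons algebra_simps)
  then show ?thesis
    using \<open>m \<noteq> n\<close> by (simp only: mult_cancel_left of_int_eq_0_iff) simp
qed (simp add: lam_0)

text \<open>
  Additivity is available for distinct indices only, so \<open>lam 2 = (lam 1)\<^sup>2\<close> has to be obtained from
  \<open>2 + (-1) = 1\<close>; the other positive exponents follow by adding 1, the negative
  ones by inversion.
\<close>
lemma lam_powi: "lam m = lam 1 powi m"
proof -
  have nonneg: "lam (int k) = lam 1 ^ k" for k
  proof (induction k)
    case (Suc k)
    show ?case
    proof (cases "k = 1")
      case True
      have "lam 1 * lam (-1) = 1" "lam 2 * lam (-1) = lam 1"
        using lam_add[of 1 "-1"] lam_add[of 2 "-1"] lam_0 by auto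
      then have "lam 2 = lam 1 * lam 1"
        by (metis mult.commute mult.left_commute mult.right_neutral)
      then show ?thesis using True by (simp add: power2_eq_square)
    next
      case False
      then show ?thesis using lam_add[of 1 "int k"] Suc by simp
    qed
  qed (simp add: lam_0)
  show ?thesis
  proof (cases "m \<ge> 0")
    case True
    then show ?thesis using nonneg[of "nat m"] by (simp add: power_int_def)
  next
    case False
    then have "lam m * lam (- m) = 1"
      using lam_add[of m "-m"] lam_0 by simp
    then show ?thesis using nonneg[of "nat (- m)"] False
      by (simp add: power_int_def field_simps lam_nonzero)
  qed
qed

lemma mu_rel: "of_int n * mu n * lam m - of_int m * mu m * lam n
   = of_int (n - m) * mu (m + n) + (if m + n = 0 then cocycle_coeff n else 0) * z2"
proof (cases "m = 0")
  case False
  show ?thesis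
    using arg_cong[OF A_rel[OF False, of n], of "\<lambda>p. coeff p 0"]
    by (simp add: A_eq of_int_poly pderiv_pCons algebra_simps)
qed (simp add: lam_0 mu_0 cocycle_coeff_def)

definition nu :: "int \<Rightarrow> complex" where "nu m = mu m / lam m"

lemma mu_eq: "mu m = lam m * nu m"
  by (simp add: nu_def lam_nonzero)

lemma nu_rel: "of_int n * nu n - of_int m * nu m
   = of_int (n - m) * nu (m + n) + (if m + n = 0 then cocycle_coeff n else 0) * z2"
proof (cases "m = n")
  case True
  then show ?thesis by (simp add: cocycle_coeff_def)
next
  case False
  have eq: "lam m * lam n * (of_int n * nu n - of_int m * nu m)
     = lam m * lam n * (of_int (n - m) * nu (m + n)) + (if m + n = 0 then cocycle_coeff n else 0) * z2"
    using mu_rel[of n m] lam_add[OF False] by (simp add: mu_eq algebra_simps)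
  have "(if m + n = 0 then cocycle_coeff n else 0) * z2
     = lam m * lam n * ((if m + n = 0 then cocycle_coeff n else 0) * z2)"
    using lam_add[OF False] lam_0 by auto
  then have "lam m * lam n * (of_int n * nu n - of_int m * nu m)
     = lam m * lam n * (of_int (n - m) * nu (m + n) + (if m + n = 0 then cocycle_coeff n else 0) * z2)"
    using eq by (simp only: distrib_left)
  then show ?thesis
    using lam_nonzero by (metis mult_cancel_left mult_eq_0_iff)
qed

text \<open>
  The relations for \<open>(-1, 1)\<close>, \<open>(2, -1)\<close> and \<open>(-2, 1)\<close> have vanishing cocycle term and give
  \<open>nu k = k \<cdot> nu 1\<close> for \<open>k = -1, 2, -2\<close>. In the relation for \<open>(2, -2)\<close> only the cocycle term
  \<open>z2 / 2\<close> then remains. Bracketing with index 1 reaches all \<open>k \<ge> 3\<close>, and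
  the relation for \<open>(k, -k)\<close> reduces negative indices to positive ones.
\<close>
lemma z2_eq: "z2 = 0" and nu_linear: "nu m = of_int m * nu 1"
proof -
  have nu_0: "nu 0 = 0" by (simp add: nu_def mu_0)
  have "- nu (-1) - nu 1 = 0"
    using nu_rel[of "-1" 1] by (simp add: nu_0 cocycle_coeff_def)
  then have nu_m1: "nu (-1) = - nu 1"
    by (metis diff_0 eq_iff_diff_eq_0 minus_minus)
  have "x = 2 * y" if "2 * x + w = 3 * y" "w = - y" for x y w :: complex
    using that by (simp add: complex_eq_iff)
  moreover have "2 * nu 2 + nu (-1) = 3 * nu 1"
    using nu_rel[of 2 "-1"] by simp
  ultimately have nu_2: "nu 2 = 2 * nu 1" using nu_m1 by blast
  have "x = - 2 * y" if "- (2 * x) - y = - (3 * w)" "w = - y" for x y w :: complex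
    using that by (simp add: complex_eq_iff)
  moreover have "- (2 * nu (-2)) - nu 1 = - (3 * nu (-1))"
    using nu_rel[of "-2" 1] by simp
  ultimately have nu_m2: "nu (-2) = - 2 * nu 1" using nu_m1 by blast
  show z2: "z2 = 0"
    using nu_rel[of 2 "-2"] by (simp add: nu_0 nu_2 nu_m2 cocycle_coeff_def)
  have nonneg: "nu (int k) = of_nat k * nu 1" for k
  proof (induction k)
    case (Suc k)
    show ?case
    proof (cases "k = 1")
      case False
      have "(of_nat k - 1) * nu (int (Suc k)) = of_nat k * nu (int k) - nu 1"
        using nu_rel[of "int k" 1] by (simp add: z2)
      also have "\<dots> = (of_nat k - 1) * (of_nat (Suc k) * nu 1)"
        unfolding Suc by (simp add: algebra_simps)
      finally show ?thesis using False by simp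
    qed (use nu_2 in simp)
  qed (simp add: nu_def mu_0)
  show "nu m = of_int m * nu 1"
  proof (cases "m \<ge> 0")
    case True
    then show ?thesis using nonneg[of "nat m"] by simp
  next
    case False
    have "of_int m * (nu m + nu (- m)) = 0"
      using nu_rel[of m "-m"] z2 by (simp add: nu_def mu_0 algebra_simps)
    then have "nu m = - nu (- m)"
      using False by (simp add: add_eq_0_iff2)
    then show ?thesis using nonneg[of "nat (- m)"] False by simp
  qed
qed

lemma LL_coeff:
  "of_int n * B m * D n - of_int m * B n * D m + of_int n * A n * pderiv (D m) - of_int m * A m * pderiv (D n)
     + of_int m ^ 2 * A m * pderiv (B n) - of_int n ^ 2 * A n * pderiv (B m)
   = of_int (n - m) * D (m + n) + [:(if m + n = 0 then cocycle_coeff n else 0) * z1:]"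
  using arg_cong[OF LL[of m n], of "\<lambda>f. coeff f 0"]
  by (simp add: a_eq b_eq coeff_c1 s_shift_linear s_shift_const coeff_deriv_x of_int_poly2
      coeff_mult_0 cscale_def algebra_simps pderiv_diff pderiv_mult pderiv_of_int power2_eq_square)

lemma pderiv_B: "pderiv (B m) = 0"
  by (cases "m = 0") (simp_all add: B_0 B_eq A_eq pderiv_pCons)

lemma B_const: "B m = [:lam m:]"
  by (cases "m = 0") (simp_all add: B_0 lam_0 B_eq A_eq pderiv_pCons one_pCons)

definition d :: "int \<Rightarrow> complex poly" where "d m = smult (inverse (lam m)) (D m)"

lemma D_eq: "D m = smult (lam m) (d m)"
  by (simp add: d_def lam_nonzero)

definition \<alpha> :: complex where "\<alpha> = - nu 1"

lemma A_eq': "A m = smult (lam m) [:- (of_int m * \<alpha>), 1:]"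
  by (simp add: A_eq mu_eq nu_linear[of m] \<alpha>_def)

text \<open>
  The case \<open>m = n\<close> is trivial. Otherwise \<open>lam (m + n) = lam m \<cdot> lam n\<close>, so dividing by \<open>lam m \<cdot> lam n\<close> removes it from the relation; the cocycle
  term is unaffected, as it only occurs where this product is 1.
\<close>
lemma d_rel: "of_int n * d n - of_int m * d m + of_int n * [:- (of_int n * \<alpha>), 1:] * pderiv (d m)
     - of_int m * [:- (of_int m * \<alpha>), 1:] * pderiv (d n)
   = of_int (n - m) * d (m + n) + [:(if m + n = 0 then cocycle_coeff n else 0) * z1:]"
proof (cases "m = n")
  case True
  then show ?thesis by (simp add: cocycle_coeff_def)
next
  case False
  let ?L = "of_int n * d n - of_int m * d m + of_int n * [:- (of_int n * \<alpha>), 1:] * pderiv (d m)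
     - of_int m * [:- (of_int m * \<alpha>), 1:] * pderiv (d n)"
  let ?k = "if m + n = 0 then cocycle_coeff n else 0"
  have "smult (lam m * lam n) ?L
    = of_int n * B m * D n - of_int m * B n * D m + of_int n * A n * pderiv (D m) - of_int m * A m * pderiv (D n)"
    by (simp add: B_const D_eq A_eq' of_int_poly pderiv_smult smult_diff_right smult_add_right mult_ac)
  also have "\<dots> = of_int (n - m) * D (m + n) + [:?k * z1:]"
    using LL_coeff[of n m] by (simp add: pderiv_B)
  also have "of_int (n - m) * D (m + n) = smult (lam m * lam n) (of_int (n - m) * d (m + n))"
    by (simp only: D_eq lam_add[OF False] mult_smult_right)
  also have "[:?k * z1:] = smult (lam m * lam n) [:?k * z1:]"
    using lam_add[OF False] lam_0 by auto
  finally have "smult (lam m * lam n) ?L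
     = smult (lam m * lam n) (of_int (n - m) * d (m + n) + [:?k * z1:])"
    by (simp only: smult_add_right)
  then show ?thesis
    by (metis smult_cancel lam_nonzero mult_eq_0_iff)
qed

lemma d_0: "d 0 = 0"
  by (simp add: d_def D_0)

lemma structure_constants_eq: "\<exists>l \<alpha> h. l \<noteq> 0 \<and> c1 = 0 \<and> c2 = 0 \<and>
  (\<forall>m. a m = cscale (l powi m) [:[:- (of_int m * \<alpha>), 1:]:] \<and> b m = cscale (l powi m) [:h_sub \<alpha> h m, 1:])"
proof -
  have z1: "z1 = 0" and d: "\<And>m. d m = h_sub \<alpha> (d 1) m"
    by (rule h_sub_unique[OF d_0 d_rel])+
  show ?thesis
  proof (rule exI[of _ "lam 1"], rule exI[of _ \<alpha>], rule exI[of _ "d 1"], intro conjI allI)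
    show "lam 1 \<noteq> 0" by (rule lam_nonzero)
    show "c1 = 0" by (rule trans[OF c1_eq]) (simp add: z1)
    show "c2 = 0" by (rule trans[OF c2_eq]) (simp add: z2_eq)
    show "a m = cscale (lam 1 powi m) [:[:- (of_int m * \<alpha>), 1:]:]" for m
      by (simp add: a_eq A_eq' cscale_def flip: lam_powi)
    show "b m = cscale (lam 1 powi m) [:h_sub \<alpha> (d 1) m, 1:]" for m
      by (simp add: b_eq D_eq B_const cscale_def flip: lam_powi d)
  qed
qed

end

section \<open>The odd structure constant\<close>

text \<open>
  The hypothesis \<open>rel\<close> is \<open>W\<^bsub>2r\<^esub> = G\<^sub>r\<^sup>2\<close> on \<open>v\<close>. Its left side has degree 0 in \<open>s\<close>, hence so has \<open>g\<close>; it has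
  degree 1 in \<open>x\<close>, which excludes that \<open>g\<close> involves \<open>x\<close>. The coefficient of \<open>x\<close> for a scalar \<open>g = \<kappa>\<close> is
  \<open>\<lambda>\<^bsup>2r\<^esup> = (2 \<lambda>\<^sup>r - \<kappa>) \<kappa>\<close>, that is \<open>(\<kappa> - \<lambda>\<^sup>r)\<^sup>2 = 0\<close>.
\<close>
lemma odd_structure_constant:
  fixes g :: poly2
  assumes "l \<noteq> 0"
    and a: "\<And>m. a m = cscale (l powi m) [:[:- (of_int m * \<alpha>), 1:]:]"
    and rel: "a (2 * r) = (2 * a r - X * g) * s_shift r g"
  shows "g = [:[:l powi r:]:]"
proof -
  define A where "A m = smult (l powi m) [:- (of_int m * \<alpha>), 1:]" for m
  have aA: "a m = [:A m:]" for m by (simp add: a A_def cscale_def)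
  have A_nz: "A m \<noteq> 0" and A_deg: "degree (A m) = 1" for m
    using assms(1) by (simp_all add: A_def)
  have nz: "2 * a r - X * g \<noteq> 0" "s_shift r g \<noteq> 0"
    using rel A_nz[of "2 * r"] by (auto simp: aA)
  have "degree (2 * a r - X * g) + degree (s_shift r g) = degree (a (2 * r))"
    unfolding rel by (rule degree_mult_eq[symmetric]) (use nz in auto)
  then have "degree g = 0" by (simp add: aA degree_s_shift)
  then obtain k where g: "g = [:k:]" by (metis degree_eq_zeroE)
  define e where "e = 2 * A r - [:0, 1:] * k"
  have "[:A (2 * r):] = ([:A r:] + [:A r:] - [:[:0, 1:] * k:]) * [:k:]"
    using rel by (simp only: aA g s_shift_const mult_2) simp
  then have Ae: "A (2 * r) = e * k"
    by (simp add: e_def mult_2 mult.commute)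
  have "e \<noteq> 0" "k \<noteq> 0" using Ae A_nz[of "2 * r"] by auto
  then have deg: "degree e + degree k = 1"
    using A_deg[of "2 * r"] by (simp add: Ae degree_mult_eq)
  have "degree k = 0"
  proof (rule ccontr)
    assume "degree k \<noteq> 0"
    then have "degree e = 0" "degree k = 1" using deg by auto
    have "[:0, 1:] * k = 2 * A r - e" by (simp add: e_def)
    then have "degree ([:0, 1:] * k) \<le> 1"
      using degree_diff_le[of "2 * A r" 1 e] \<open>degree e = 0\<close> degree_mult_le[of 2 "A r"] A_deg[of r]
      by simp
    then show False
      using \<open>degree k = 1\<close> \<open>k \<noteq> 0\<close> by (simp add: degree_mult_eq)
  qed
  then obtain \<kappa> where k: "k = [:\<kappa>:]" by (metis degree_eq_zeroE)
  have "l powi (2 * r) = (2 * l powi r - \<kappa>) * \<kappa>"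
    using arg_cong[OF Ae, of "\<lambda>p. coeff p 1"]
    by (simp add: A_def e_def k numeral_poly algebra_simps)
  moreover have "l powi (2 * r) = l powi r * l powi r"
    using assms(1) by (metis mult_2 power_int_add)
  ultimately have "(\<kappa> - l powi r) * (\<kappa> - l powi r) = 0"
    by (simp add: algebra_simps)
  then show ?thesis by (simp add: g k)
qed

section \<open>The generators acting on a module\<close>

locale ramond_module =
  fixes V :: "(bms, 'v::ab_group_add) super_module"
  assumes module: "is_super_module ramond_bms V"
begin

sublocale vs: vector_space "scal V"
  using module unfolding is_super_module_def is_super_space_def by blast

text \<open>
  A constant instead of the abbreviation \<open>gen_act\<close>: with the latter, rewriting \<open>act V (gterm c b)\<close>
  as a multiple of \<open>act V (gterm 1 b)\<close> would not terminate.
\<close>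
definition gen :: "bms_gen \<Rightarrow> 'v \<Rightarrow> 'v" where "gen b = gen_act V b"

lemma gen_hom: "module_hom (scal V) (scal V) (gen b)"
  unfolding gen_def
  using module unfolding is_super_module_def Vector_Spaces.linear_def by blast

lemma algebra_hom: "module_hom bms_scal (scal V) (\<lambda>x. act V x u)"
proof -
  have "module_hom (scal ramond_bms) (scal V) (\<lambda>x. act V x u)"
    using module unfolding is_super_module_def Vector_Spaces.linear_def by blast
  then show ?thesis by (simp add: ramond_bms_def)
qed

lemmas gen_add = module_hom.add[OF gen_hom]
  and gen_scale = module_hom.scale[OF gen_hom]
  and gen_zero = module_hom.zero[OF gen_hom]
  and gen_diff = module_hom.diff[OF gen_hom]
  and gen_sum = module_hom.sum[OF gen_hom]

lemmas algebra_add = module_hom.add[OF algebra_hom]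
  and algebra_scale = module_hom.scale[OF algebra_hom]
  and algebra_zero = module_hom.zero[OF algebra_hom]
  and algebra_sum = module_hom.sum[OF algebra_hom]

lemma act_single: "act V (gterm c b) u = scal V c (gen b u)"
proof -
  have "gterm c b = bms_scal c (gterm 1 b)"
    by (simp add: bms_scal_def)
  then show ?thesis by (simp only: algebra_scale gen_def)
qed

lemma act_eq_sum: "act V x u = (\<Sum>b\<in>Poly_Mapping.keys x. scal V (Poly_Mapping.lookup x b) (gen b u))"
proof -
  have "x = (\<Sum>b\<in>Poly_Mapping.keys x. gterm (Poly_Mapping.lookup x b) b)"
    by (rule poly_mapping_eqI)
      (auto simp: lookup_sum lookup_single when_def sum.delta in_keys_iff)
  then have "act V x u = act V (\<Sum>b\<in>Poly_Mapping.keys x. gterm (Poly_Mapping.lookup x b) b) u"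
    by (rule arg_cong)
  then show ?thesis by (simp only: algebra_sum act_single)
qed

lemma bracket_relation:
  "gen x (gen y u) - scal V (koszul_sign (odd_gen x) (odd_gen y)) (gen y (gen x u)) = act V (gen_bracket x y) u"
proof -
  have "gterm 1 b \<in> part ramond_bms (odd_gen b)" for b
    by (simp add: ramond_bms_def)
  moreover have "bracket ramond_bms (gterm 1 x) (gterm 1 y) = gen_bracket x y"
  proof -
    have "bms_scal 1 z = z" for z
      by (rule poly_mapping_eqI) (simp add: bms_scal_def map.rep_eq when_def)
    then show ?thesis by (simp add: ramond_bms_def bms_bracket_def)
  qed
  ultimately show ?thesis
    using module unfolding gen_def by (metis is_super_module_def)
qed

lemma gen_parity: "u \<in> part V p \<Longrightarrow> gen b u \<in> part V (odd_gen b \<noteq> p)"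
proof -
  assume "u \<in> part V p"
  moreover have "gterm 1 b \<in> part ramond_bms (odd_gen b)"
    by (simp add: ramond_bms_def)
  ultimately show ?thesis
    using module unfolding is_super_module_def gen_def by blast
qed

lemma super_space: "is_super_space V"
  using module unfolding is_super_module_def by (rule conjunct1)

lemma part_subspace: "vs.subspace (part V p)"
  using super_space unfolding is_super_space_def by (elim conjE) (rule spec)

lemma part_Int: "part V False \<inter> part V True = {0}"
  using super_space unfolding is_super_space_def by (elim conjE)

lemma L_L: "gen (L m) (gen (L n) u) - gen (L n) (gen (L m) u)
    = scal V (of_int (n - m)) (gen (L (m + n)) u) + scal V (if m + n = 0 then cocycle_coeff n else 0) (gen C1 u)"
  using bracket_relation[of "L m" "L n" u]
  by (simp add: koszul_sign_def algebra_add act_single del: of_int_diff)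

lemma L_W: "gen (L m) (gen (W n) u) - gen (W n) (gen (L m) u)
    = scal V (of_int (n - m)) (gen (W (m + n)) u) + scal V (if m + n = 0 then cocycle_coeff n else 0) (gen C2 u)"
  using bracket_relation[of "L m" "W n" u]
  by (simp add: koszul_sign_def algebra_add act_single del: of_int_diff)

lemma L_G: "gen (L m) (gen (G r) u) - gen (G r) (gen (L m) u) = scal V (of_int r - of_int m / 2) (gen (G (m + r)) u)"
  using bracket_relation[of "L m" "G r" u]
  by (simp add: koszul_sign_def act_single)

lemma G_G: "gen (G r) (gen (G s) u) + gen (G s) (gen (G r) u) = scal V 2 (gen (W (r + s)) u)
    + scal V (if r + s = 0 then (of_int r ^ 2 - 1 / 4) / 3 else 0) (gen C2 u)"
  using bracket_relation[of "G r" "G s" u]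
  by (simp add: koszul_sign_def act_single algebra_add)

lemma W_W: "gen (W m) (gen (W n) u) = gen (W n) (gen (W m) u)"
  using bracket_relation[of "W m" "W n" u]
  by (simp add: koszul_sign_def algebra_zero)

lemma W_G: "gen (W m) (gen (G r) u) = gen (G r) (gen (W m) u)"
  using bracket_relation[of "W m" "G r" u]
  by (simp add: koszul_sign_def algebra_zero)

lemma C1_central: "gen C1 (gen y u) = gen y (gen C1 u)"
  using bracket_relation[of C1 y u]
  by (cases y) (simp_all add: koszul_sign_def algebra_zero)

lemma C2_central: "gen C2 (gen y u) = gen y (gen C2 u)"
  using bracket_relation[of C2 y u]
  by (cases y) (simp_all add: koszul_sign_def algebra_zero)

lemma L_0: "gen (L m) (gen (L 0) u) = gen (L 0) (gen (L m) u) - scal V (of_int m) (gen (L m) u)"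
  using L_L[of m 0 u] by (simp add: cocycle_coeff_def algebra_simps)

lemma W_L_0: "gen (W m) (gen (L 0) u) = gen (L 0) (gen (W m) u) - scal V (of_int m) (gen (W m) u)"
  using L_W[of 0 m u] by (simp add: cocycle_coeff_def algebra_simps)

lemma G_L_0: "gen (G m) (gen (L 0) u) = gen (L 0) (gen (G m) u) - scal V (of_int m) (gen (G m) u)"
  using L_G[of 0 m u] by (simp add: algebra_simps)

lemma L_W_0: "gen (L m) (gen (W 0) u) = gen (W 0) (gen (L m) u) - scal V (of_int m) (gen (W m) u)"
  using L_W[of m 0 u] by (simp add: cocycle_coeff_def algebra_simps)

end

section \<open>Modules generated freely by an even vector\<close>

lemma degrees_bounded:
  fixes f :: poly2
  obtains M where "\<And>i. degree (coeff f i) \<le> M"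
proof -
  have "degree (coeff f i) \<le> (\<Sum>i\<le>degree f. degree (coeff f i))" for i
    by (cases "i \<le> degree f") (auto intro: member_le_sum simp: coeff_eq_0)
  then show ?thesis using that by blast
qed

text \<open>
  The two ring identities are the induction steps for \<open>L\<^sub>m\<close>, with \<open>h\<close> the shifted polynomial, \<open>d\<close> its
  derivative in \<open>x\<close>, and \<open>k\<close> standing for \<open>m\<close>.
\<close>
lemma shift_X_identity:
  fixes x :: "'a::comm_ring_1"
  shows "b * (x * h) - k * a * (h + x * d) = x * (b * h - k * a * d) - k * (a * h)"
  by (simp add: algebra_simps)

lemma shift_S_identity:
  fixes s :: "'a::comm_ring_1"
  shows "b * ((s - k) * h) - k * a * ((s - k) * d) = s * (b * h - k * a * d) - k * (b * h - k * a * d)"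
  by (simp add: algebra_simps)

locale ramond_module_generated = ramond_module V for V :: "(bms, 'v::ab_group_add) super_module" +
  fixes v :: 'v
  assumes even: "v \<in> part V False"
    and free: "\<exists>!(p, q). u = poly2_act V p v + gen_act V (G 0) (poly2_act V q v)"
begin

definition P :: "poly2 \<Rightarrow> 'v" where "P f = poly2_act V f v"

definition Q :: "poly2 \<Rightarrow> 'v" where "Q f = gen (G 0) (P f)"

text \<open>
  Extending the sum to a common rectangle of exponents makes the sums of two polynomials comparable.
\<close>
lemma P_eq_rectangle_sum:
  assumes "degree f \<le> N" "\<And>i. degree (coeff f i) \<le> M"
  shows "P f = (\<Sum>i\<le>N. \<Sum>j\<le>M. scal V (coeff (coeff f i) j) ((gen (L 0) ^^ i) ((gen (W 0) ^^ j) v)))"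
proof -
  have "P f = (\<Sum>i\<le>degree f. \<Sum>j\<le>M. scal V (coeff (coeff f i) j) ((gen (L 0) ^^ i) ((gen (W 0) ^^ j) v)))"
    unfolding P_def poly2_act_def gen_def
    by (intro sum.cong refl sum.mono_neutral_left) (use assms(2) in \<open>auto simp: coeff_eq_0\<close>)
  also have "\<dots> = (\<Sum>i\<le>N. \<Sum>j\<le>M. scal V (coeff (coeff f i) j) ((gen (L 0) ^^ i) ((gen (W 0) ^^ j) v)))"
    by (intro sum.mono_neutral_left) (use assms(1) in \<open>auto simp: coeff_eq_0\<close>)
  finally show ?thesis .
qed

lemma P_add: "P (f + g) = P f + P g"
proof -
  obtain M1 where M1: "\<And>i. degree (coeff f i) \<le> M1" using degrees_bounded by blast
  obtain M2 where M2: "\<And>i. degree (coeff g i) \<le> M2" using degrees_bounded by blast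
  define N where "N = max (degree f) (degree g)"
  define M where "M = max M1 M2"
  have f: "degree f \<le> N" "\<And>i. degree (coeff f i) \<le> M"
    and g: "degree g \<le> N" "\<And>i. degree (coeff g i) \<le> M"
    using M1 M2 by (auto simp: N_def M_def le_max_iff_disj)
  have fg: "degree (f + g) \<le> N" "\<And>i. degree (coeff (f + g) i) \<le> M"
    using f g by (auto intro: degree_add_le)
  show ?thesis
    unfolding P_eq_rectangle_sum[OF f] P_eq_rectangle_sum[OF g] P_eq_rectangle_sum[OF fg]
    by (simp add: sum.distrib vs.scale_left_distrib)
qed

lemma P_cscale: "P (cscale c f) = scal V c (P f)"
proof -
  obtain M where M: "\<And>i. degree (coeff f i) \<le> M" using degrees_bounded by blast
  have *: "degree (cscale c f) \<le> degree f" "\<And>i. degree (coeff (cscale c f) i) \<le> M"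
    using M by (auto simp: cscale_def degree_smult_le intro: order.trans[OF degree_smult_le])
  show ?thesis
    unfolding P_eq_rectangle_sum[OF *] P_eq_rectangle_sum[OF order.refl M]
    by (simp add: vs.scale_sum_right cscale_def)
qed

lemma P_S: "P (S * f) = gen (L 0) (P f)"
proof -
  obtain M where M: "\<And>i. degree (coeff f i) \<le> M" using degrees_bounded by blast
  have *: "degree (S * f) \<le> Suc (degree f)" "\<And>i. degree (coeff (S * f) i) \<le> M"
    using M by (auto simp: degree_pCons_le coeff_pCons split: nat.split)
  show ?thesis
    unfolding P_eq_rectangle_sum[OF *] P_eq_rectangle_sum[OF order.refl M]
    by (subst sum.atMost_Suc_shift) (simp add: gen_sum gen_scale)
qed

lemma L_0_pow_W_0: "(gen (L 0) ^^ i) (gen (W 0) u) = gen (W 0) ((gen (L 0) ^^ i) u)"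
  by (induction i) (simp_all add: W_L_0)

lemma P_X: "P (X * f) = gen (W 0) (P f)"
proof -
  obtain M where M: "\<And>i. degree (coeff f i) \<le> M" using degrees_bounded by blast
  have X: "coeff (X * f) i = pCons 0 (coeff f i)" for i by simp
  have *: "degree (X * f) \<le> degree f" "\<And>i. degree (coeff (X * f) i) \<le> Suc M"
    using M by (auto simp del: mult_pCons_left simp: X intro: order.trans[OF degree_pCons_le])
       (simp add: degree_smult_le)
  show ?thesis
    unfolding P_eq_rectangle_sum[OF *] P_eq_rectangle_sum[OF order.refl M] X
    by (subst sum.atMost_Suc_shift) (simp add: gen_sum gen_scale L_0_pow_W_0)
qed

lemma P_1: "P 1 = v"
  by (simp add: P_def poly2_act_def)

lemma P_minus: "P (- f) = - P f"
proof -
  have "- f = cscale (- 1) f" by (rule poly_eqI) (simp add: cscale_def)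
  then show ?thesis by (simp add: P_cscale)
qed

lemma P_diff: "P (f - g) = P f - P g"
  using P_add[of f "- g"] by (simp add: P_minus)

lemma P_0: "P 0 = 0"
  using P_diff[of 0 0] by simp

lemma P_of_int: "P (of_int m * f) = scal V (of_int m) (P f)"
  by (simp add: P_cscale flip: cscale_of_int)

lemma Q_add: "Q (f + g) = Q f + Q g"
  and Q_diff: "Q (f - g) = Q f - Q g"
  and Q_cscale: "Q (cscale c f) = scal V c (Q f)"
  and Q_0: "Q 0 = 0"
  by (simp_all add: Q_def P_add P_diff P_cscale P_0 gen_add gen_diff gen_scale gen_zero)

lemma Q_S: "Q (S * f) = gen (L 0) (Q f)"
  using G_L_0[of 0] by (simp only: Q_def P_S) simp

lemma Q_X: "Q (X * f) = gen (W 0) (Q f)"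
  by (simp only: Q_def P_X W_G)

lemma P_even: "P f \<in> part V False"
proof (induction f rule: poly2_induct)
  case one
  then show ?case by (simp add: P_1 even)
next
  case (add f g)
  then show ?case using part_subspace by (simp add: P_add vs.subspace_add)
next
  case (cscale c f)
  then show ?case using part_subspace by (simp add: P_cscale vs.subspace_scale)
next
  case (X f)
  then show ?case using gen_parity[of _ False "W 0"] by (simp only: P_X) simp
next
  case (S f)
  then show ?case using gen_parity[of _ False "L 0"] by (simp only: P_S) simp
qed

lemma Q_odd: "Q f \<in> part V True"
  using gen_parity[OF P_even, of "G 0" f] by (simp add: Q_def)

lemma decomposition_ex1: "\<exists>!x. case x of (p, q) \<Rightarrow> u = P p + Q q"
  using free[of u] unfolding P_def Q_def gen_def .

lemma decomposition_unique:
  assumes "P f + Q g = P f' + Q g'" shows "f = f' \<and> g = g'"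
proof -
  have "(THE x. case x of (p, q) \<Rightarrow> P f + Q g = P p + Q q) = (f, g)"
    "(THE x. case x of (p, q) \<Rightarrow> P f + Q g = P p + Q q) = (f', g')"
    by (rule the1_equality[OF decomposition_ex1], use assms in simp)+
  then show ?thesis by simp
qed

lemma P_inj: "P f = P g \<Longrightarrow> f = g"
  using decomposition_unique[of f 0 g 0] by simp

lemma decomposition: obtains f g where "u = P f + Q g"
proof -
  obtain x where "case x of (p, q) \<Rightarrow> u = P p + Q q"
    using ex1_implies_ex[OF decomposition_ex1] by (rule exE)
  then show ?thesis using that by (cases x) simp
qed

lemma even_obtain:
  assumes "u \<in> part V False" shows "\<exists>f. u = P f"
proof -
  obtain f g where u: "u = P f + Q g" by (rule decomposition)
  have "u - P f \<in> part V False"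
    using assms P_even part_subspace vs.subspace_diff by blast
  then have "Q g \<in> part V False \<inter> part V True" using u Q_odd by simp
  then show ?thesis using u part_Int by auto
qed

lemma odd_obtain:
  assumes "u \<in> part V True" shows "\<exists>g. u = Q g"
proof -
  obtain f g where u: "u = P f + Q g" by (rule decomposition)
  have "u - Q g \<in> part V True"
    using assms Q_odd part_subspace vs.subspace_diff by blast
  then have "P f \<in> part V False \<inter> part V True" using u P_even by simp
  then show ?thesis using u part_Int by auto
qed

text \<open>
  An operator that satisfies \<open>T L\<^sub>0 = (L\<^sub>0 - m) T\<close> and commutes with \<open>W\<^sub>0\<close> is determined by its value at \<open>v\<close>. The
  target \<open>R\<close> is \<open>P\<close> for \<open>T = W\<^sub>m\<close> and for the central elements, and \<open>Q\<close> for the odd \<open>G\<^sub>m\<close>.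
\<close>
lemma intertwine_W:
  assumes T: "\<And>x y. T (x + y) = T x + T y" "\<And>c x. T (scal V c x) = scal V c (T x)"
    "\<And>u. T (gen (L 0) u) = gen (L 0) (T u) - scal V (of_int m) (T u)"
    "\<And>u. T (gen (W 0) u) = gen (W 0) (T u)"
    and R: "\<And>f g. R (f - g) = R f - R g" "\<And>f g. R (f + g) = R f + R g" "\<And>c f. R (cscale c f) = scal V c (R f)"
    "\<And>f. R (S * f) = gen (L 0) (R f)" "\<And>f. R (X * f) = gen (W 0) (R f)"
    and v: "T v = R a"
  shows "T (P f) = R (a * s_shift m f)"
proof (induction f rule: poly2_induct)
  case one
  then show ?case by (simp add: P_1 v s_shift_1)
next
  case (add f g)
  then show ?case by (simp add: P_add T s_shift_add distrib_left R)
next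
  case (cscale c f)
  have "a * s_shift m (cscale c f) = cscale c (a * s_shift m f)"
    unfolding s_shift_cscale by (simp add: cscale_def)
  then show ?case using cscale by (simp add: P_cscale T R)
next
  case (X f)
  have "a * s_shift m (X * f) = X * (a * s_shift m f)"
    by (simp only: s_shift_mult s_shift_const mult.left_commute)
  then show ?case using X by (simp only: P_X T R)
next
  case (S f)
  have "a * s_shift m (S * f) = S * (a * s_shift m f) - cscale (of_int m) (a * s_shift m f)"
    unfolding s_shift_mult s_shift_linear cscale_of_int
    by (simp add: algebra_simps of_int_poly2)
  then show ?case using S by (simp only: P_S T R)
qed

text \<open>
  The bracket \<open>[L\<^sub>m, W\<^sub>0] = -m W\<^sub>m\<close> makes \<open>L\<^sub>m\<close> act on the powers of \<open>W\<^sub>0\<close> as the derivation \<open>-m W\<^sub>m \<partial>\<^sub>x\<close>, up to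
  the shift.
\<close>
lemma intertwine_L:
  assumes T: "\<And>x y. T (x + y) = T x + T y" "\<And>c x. T (scal V c x) = scal V c (T x)"
    "\<And>u. T (gen (L 0) u) = gen (L 0) (T u) - scal V (of_int m) (T u)"
    "\<And>u. T (gen (W 0) u) = gen (W 0) (T u) - scal V (of_int m) (T' u)"
    and T': "\<And>f. T' (P f) = P (a * s_shift m f)"
    and v: "T v = P b"
  shows "T (P f) = P (b * s_shift m f - of_int m * a * deriv_x (s_shift m f))"
proof (induction f rule: poly2_induct)
  case one
  then show ?case by (simp add: P_1 v s_shift_1 deriv_x_1)
next
  case (add f g)
  have "b * s_shift m (f + g) - of_int m * a * deriv_x (s_shift m (f + g))
    = (b * s_shift m f - of_int m * a * deriv_x (s_shift m f)) + (b * s_shift m g - of_int m * a * deriv_x (s_shift m g))"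
    by (simp add: s_shift_add deriv_x_add algebra_simps)
  then show ?case using add by (simp only: P_add T)
next
  case (cscale c f)
  have "b * s_shift m (cscale c f) - of_int m * a * deriv_x (s_shift m (cscale c f))
    = cscale c (b * s_shift m f - of_int m * a * deriv_x (s_shift m f))"
    unfolding s_shift_cscale deriv_x_cscale by (simp add: cscale_def smult_diff_right)
  then show ?case using cscale by (simp only: P_cscale T)
next
  case (X f)
  have dX: "deriv_x (X * h) = h + X * deriv_x h" for h
    by (simp add: deriv_x_smult pderiv_pCons pCons_one)
  have "b * s_shift m (X * f) - of_int m * a * deriv_x (s_shift m (X * f))
    = X * (b * s_shift m f - of_int m * a * deriv_x (s_shift m f)) - cscale (of_int m) (a * s_shift m f)"
    unfolding s_shift_mult s_shift_const cscale_of_int dX by (rule shift_X_identity)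
  moreover have "T (P (X * f)) = gen (W 0) (T (P f)) - scal V (of_int m) (T' (P f))"
    by (simp only: P_X T(4))
  ultimately show ?case
    by (simp only: X T' P_X P_diff P_cscale)
next
  case (S f)
  have lin: "[:0 - of_int m * 1, 1:] = S - of_int m"
    by (simp add: of_int_poly2)
  have dS: "deriv_x ((S - of_int m) * h) = (S - of_int m) * deriv_x h" for h
    by (simp add: left_diff_distrib deriv_x_diff deriv_x_pCons of_int_poly2 deriv_x_smult pderiv_of_int)
  have "b * s_shift m (S * f) - of_int m * a * deriv_x (s_shift m (S * f))
    = S * (b * s_shift m f - of_int m * a * deriv_x (s_shift m f))
      - cscale (of_int m) (b * s_shift m f - of_int m * a * deriv_x (s_shift m f))"
    unfolding s_shift_mult s_shift_linear lin dS cscale_of_int by (rule shift_S_identity)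
  moreover have "T (P (S * f)) = gen (L 0) (T (P f)) - scal V (of_int m) (T (P f))"
    by (simp only: P_S T(3))
  ultimately show ?case
    by (simp only: S P_S P_diff P_cscale)
qed

definition a :: "int \<Rightarrow> poly2" where "a m = (SOME f. gen (W m) v = P f)"
definition b :: "int \<Rightarrow> poly2" where "b m = (SOME f. gen (L m) v = P f)"
definition g :: "int \<Rightarrow> poly2" where "g m = (SOME f. gen (G m) v = Q f)"
definition c1 :: poly2 where "c1 = (SOME f. gen C1 v = P f)"
definition c2 :: poly2 where "c2 = (SOME f. gen C2 v = P f)"

lemma W_v: "gen (W m) v = P (a m)"
  unfolding a_def by (rule someI_ex, rule even_obtain) (use gen_parity[OF even, of "W m"] in simp)

lemma L_v: "gen (L m) v = P (b m)"
  unfolding b_def by (rule someI_ex, rule even_obtain) (use gen_parity[OF even, of "L m"] in simp)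

lemma G_v: "gen (G m) v = Q (g m)"
  unfolding g_def by (rule someI_ex, rule odd_obtain) (use gen_parity[OF even, of "G m"] in simp)

lemma C1_v: "gen C1 v = P c1"
  unfolding c1_def by (rule someI_ex, rule even_obtain) (use gen_parity[OF even, of "C1"] in simp)

lemma C2_v: "gen C2 v = P c2"
  unfolding c2_def by (rule someI_ex, rule even_obtain) (use gen_parity[OF even, of "C2"] in simp)

lemmas P_props = P_diff P_add P_cscale P_S P_X
lemmas Q_props = Q_diff Q_add Q_cscale Q_S Q_X

lemma W_P: "gen (W m) (P f) = P (a m * s_shift m f)"
  by (rule intertwine_W[where T = "gen (W m)" and R = P, OF gen_add gen_scale W_L_0 W_W P_props W_v])

lemma G_P: "gen (G m) (P f) = Q (g m * s_shift m f)"
  by (rule intertwine_W[where T = "gen (G m)" and R = Q, OF gen_add gen_scale G_L_0 W_G[symmetric] Q_props G_v])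

lemma L_P: "gen (L m) (P f) = P (b m * s_shift m f - of_int m * a m * deriv_x (s_shift m f))"
  by (rule intertwine_L[where T = "gen (L m)" and T' = "gen (W m)", OF gen_add gen_scale L_0 L_W_0 W_P L_v])

lemma C1_P: "gen C1 (P f) = P (c1 * f)"
proof -
  have "gen C1 (gen (L 0) u) = gen (L 0) (gen C1 u) - scal V (of_int 0) (gen C1 u)" for u
    by (subst C1_central) simp
  from intertwine_W[where T = "gen C1" and m = 0 and R = P, OF gen_add gen_scale this C1_central P_props C1_v]
  show ?thesis by (simp only: s_shift_zero_shift)
qed

lemma C2_P: "gen C2 (P f) = P (c2 * f)"
proof -
  have "gen C2 (gen (L 0) u) = gen (L 0) (gen C2 u) - scal V (of_int 0) (gen C2 u)" for u
    by (subst C2_central) simp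
  from intertwine_W[where T = "gen C2" and m = 0 and R = P, OF gen_add gen_scale this C2_central P_props C2_v]
  show ?thesis by (simp only: s_shift_zero_shift)
qed

sublocale sc: structure_constants a b c1 c2
proof
  show "a 0 = X"
    by (rule P_inj) (metis P_X P_1 W_v mult.right_neutral)
  show "b 0 = S"
    by (rule P_inj) (metis P_S P_1 L_v mult.right_neutral)
  fix m n
  show "a m * s_shift m (a n) = a n * s_shift n (a m)"
    by (rule P_inj) (metis W_P W_v W_W)
  show "b m * s_shift m (a n) - of_int m * a m * deriv_x (s_shift m (a n)) - a n * s_shift n (b m)
      = of_int (n - m) * a (m + n) + cscale (if m + n = 0 then cocycle_coeff n else 0) c2"
    using L_W[of m n v] unfolding W_v L_v C2_v L_P W_P
    by (intro P_inj) (simp only: P_add P_diff P_of_int P_cscale)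
  show "(b m * s_shift m (b n) - of_int m * a m * deriv_x (s_shift m (b n)))
        - (b n * s_shift n (b m) - of_int n * a n * deriv_x (s_shift n (b m)))
      = of_int (n - m) * b (m + n) + cscale (if m + n = 0 then cocycle_coeff n else 0) c1"
    using L_L[of m n v] unfolding L_v C1_v L_P
    by (intro P_inj) (simp only: P_add P_diff P_of_int P_cscale)
  show "a m * s_shift m c1 = c1 * a m"
    by (rule P_inj) (metis W_P W_v C1_P C1_v C1_central)
  show "a m * s_shift m c2 = c2 * a m"
    by (rule P_inj) (metis W_P W_v C2_P C2_v C2_central)
  show "b m * s_shift m c1 - of_int m * a m * deriv_x (s_shift m c1) = c1 * b m"
    by (rule P_inj) (metis L_P L_v C1_P C1_v C1_central)
  show "b m * s_shift m c2 - of_int m * a m * deriv_x (s_shift m c2) = c2 * b m"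
    by (rule P_inj) (metis L_P L_v C2_P C2_v C2_central)
qed

text \<open>
  Both central elements kill \<open>v\<close>, and \<open>v\<close> generates \<open>V\<close>.
\<close>
lemma C1_zero: "gen C1 u = 0" and C2_zero: "gen C2 u = 0"
proof -
  have c: "c1 = 0" "c2 = 0" using sc.structure_constants_eq by blast+
  obtain f h where "u = P f + Q h" by (rule decomposition)
  then show "gen C1 u = 0" "gen C2 u = 0"
    by (simp_all add: gen_add Q_def C1_central[of "G 0"] C2_central[of "G 0"] C1_P C2_P c P_0 gen_zero)
qed

text \<open>In general \<open>G\<^sub>0\<^sup>2 = W\<^sub>0 - C\<^sub>2 / 24\<close>; the correction is gone by now.\<close>
lemma G_0_square: "gen (G 0) (gen (G 0) u) = gen (W 0) u"
proof -
  have "scal V 2 (gen (G 0) (gen (G 0) u)) = scal V 2 (gen (W 0) u)"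
    using G_G[of 0 0 u] vs.scale_left_distrib[of 1 1 "gen (G 0) (gen (G 0) u)"] by (simp add: C2_zero)
  then show ?thesis by simp
qed

lemma G_0_Q: "gen (G 0) (Q f) = P (X * f)"
  by (simp only: Q_def G_0_square P_X)

lemma G_Q: "gen (G m) (Q f) = P ((2 * a m - X * g m) * s_shift m f)"
proof -
  have "gen (G m) (Q f) + gen (G 0) (gen (G m) (P f)) = scal V 2 (gen (W m) (P f))"
    using G_G[of m 0 "P f"] by (simp add: Q_def C2_zero)
  then have "gen (G m) (Q f) = scal V 2 (gen (W m) (P f)) - gen (G 0) (gen (G m) (P f))"
    by (simp only: eq_diff_eq)
  also have "gen (G 0) (gen (G m) (P f)) = P (X * (g m * s_shift m f))"
    by (simp only: G_P G_0_Q)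
  also have "scal V 2 (gen (W m) (P f)) - P (X * (g m * s_shift m f))
     = P (of_int 2 * (a m * s_shift m f) - X * (g m * s_shift m f))"
    by (simp only: P_diff P_of_int W_P) simp
  also have "of_int 2 * (a m * s_shift m f) - X * (g m * s_shift m f) = (2 * a m - X * g m) * s_shift m f"
    by (simp only: algebra_simps of_int_numeral)
  finally show ?thesis .
qed

lemma G_square: "gen (G m) (gen (G m) u) = gen (W (2 * m)) u"
proof -
  have "scal V 2 (gen (G m) (gen (G m) u)) = scal V 2 (gen (W (2 * m)) u)"
    using G_G[of m m u] vs.scale_left_distrib[of 1 1 "gen (G m) (gen (G m) u)"]
    by (simp add: C2_zero)
  then show ?thesis by simp
qed

lemma g_eq_power:
  assumes "l \<noteq> 0" "\<And>m. a m = cscale (l powi m) [:[:- (of_int m * \<alpha>), 1:]:]"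
  shows "g m = [:[:l powi m:]:]"
proof -
  have "a (2 * m) = (2 * a m - X * g m) * s_shift m (g m)"
    by (rule P_inj) (simp only: G_Q[symmetric] G_v[symmetric] G_square W_v)
  then show ?thesis
    by (rule odd_structure_constant[OF assms])
qed

definition \<Psi> :: "poly2 \<times> poly2 \<Rightarrow> 'v" where "\<Psi> w = P (fst w) + Q (snd w)"

lemma \<Psi>_bij: "bij \<Psi>"
proof (rule bijI')
  show "\<Psi> x = \<Psi> y \<longleftrightarrow> x = y" for x y
  proof
    assume "\<Psi> x = \<Psi> y"
    then have "fst x = fst y \<and> snd x = snd y"
      unfolding \<Psi>_def by (rule decomposition_unique)
    then show "x = y" by (simp add: prod_eq_iff)
  qed simp
  show "\<exists>x. y = \<Psi> x" for y
  proof -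
    obtain p q where "y = P p + Q q" by (rule decomposition)
    then have "y = \<Psi> (p, q)" by (simp add: \<Psi>_def)
    then show ?thesis ..
  qed
qed

lemma \<Psi>_add: "\<Psi> (x + y) = \<Psi> x + \<Psi> y"
  by (simp add: \<Psi>_def P_add Q_add)

lemma \<Psi>_scale: "\<Psi> (pair_scale c x) = scal V c (\<Psi> x)"
  by (simp add: \<Psi>_def pair_scale_def P_cscale Q_cscale vs.scale_right_distrib)

lemma \<Psi>_sum: "\<Psi> (sum f I) = (\<Sum>i\<in>I. \<Psi> (f i))"
proof (induction I rule: infinite_finite_induct)
  case (insert x F)
  then show ?case by (simp add: \<Psi>_add)
qed (simp_all add: \<Psi>_def P_0 Q_0)

lemma \<Psi>_part: "\<Psi> ` part (omega l \<alpha> h) p = part V p"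
proof (cases p)
  case True
  have "\<Psi> ` ({0} \<times> UNIV) = range Q"
    by (auto simp: \<Psi>_def P_0 image_iff)
  also have "\<dots> = part V True" using Q_odd odd_obtain by blast
  finally show ?thesis using True by (simp add: omega_def)
next
  case False
  have "\<Psi> ` (UNIV \<times> {0}) = range P"
    by (auto simp: \<Psi>_def Q_0 image_iff)
  also have "\<dots> = part V False" using P_even even_obtain by blast
  finally show ?thesis using False by (simp add: omega_def)
qed

text \<open>
  On the even part the formulas are those for \<open>P\<close>. On the odd part \<open>L\<^sub>m G\<^sub>0 = G\<^sub>0 L\<^sub>m - (m/2) G\<^sub>m\<close> produces the
  summand \<open>- m/2\<close>, and \<open>G\<^sub>m G\<^sub>0 = 2 W\<^sub>m - G\<^sub>0 G\<^sub>m\<close> produces \<open>2 (x - m \<alpha>) - x = x - 2 m \<alpha>\<close>.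
\<close>
lemma \<Psi>_gen:
  assumes "l \<noteq> 0"
    and a: "\<And>m. a m = cscale (l powi m) [:[:- (of_int m * \<alpha>), 1:]:]"
    and b: "\<And>m. b m = cscale (l powi m) [:h_sub \<alpha> h m, 1:]"
  shows "\<Psi> (omega_gen l \<alpha> h x w) = gen x (\<Psi> w)"
proof -
  obtain p q where w: "w = (p, q)" by force
  have G_P': "gen (G m) (P f) = Q (cscale (l powi m) (s_shift m f))" for m f
    using g_eq_power[OF assms(1) a] by (simp add: G_P cscale_def)
  have W_Q: "gen (W m) (Q f) = Q (a m * s_shift m f)" for m f
    by (simp only: Q_def W_G W_P)
  have W: "a m * s_shift m f = cscale (l powi m) (smult [:- (of_int m * \<alpha>), 1:] (s_shift m f))" for m f
    by (simp add: a cscale_def)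
  have Lp: "b m * s_shift m f - of_int m * a m * deriv_x (s_shift m f)
    = cscale (l powi m) ([:h_sub \<alpha> h m, 1:] * s_shift m f
         - smult (smult (of_int m) [:- (of_int m * \<alpha>), 1:]) (deriv_x (s_shift m f)))" for m f
    by (simp add: a b cscale_eq_mult of_int_poly2 of_int_poly smult_diff_right smult_add_right mult_ac)
  have L_Q: "gen (L m) (Q f) = Q (cscale (l powi m) ([:h_sub \<alpha> h m - [:of_int m / 2:], 1:] * s_shift m f
         - smult (smult (of_int m) [:- (of_int m * \<alpha>), 1:]) (deriv_x (s_shift m f))))" for m f
  proof -
    have "gen (L m) (Q f) - gen (G 0) (gen (L m) (P f)) = - scal V (of_int m / 2) (gen (G m) (P f))"
      using L_G[of m 0 "P f"] by (simp add: Q_def)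
    then have "gen (L m) (Q f) = gen (G 0) (gen (L m) (P f)) - scal V (of_int m / 2) (gen (G m) (P f))"
      by (simp add: diff_eq_eq)
    also have "\<dots> = Q (b m * s_shift m f - of_int m * a m * deriv_x (s_shift m f)
       - cscale (of_int m / 2) (cscale (l powi m) (s_shift m f)))"
      unfolding L_P Q_def[symmetric] by (simp only: G_P' Q_diff Q_cscale)
    also have "b m * s_shift m f - of_int m * a m * deriv_x (s_shift m f)
       - cscale (of_int m / 2) (cscale (l powi m) (s_shift m f))
      = cscale (l powi m) ([:h_sub \<alpha> h m - [:of_int m / 2:], 1:] * s_shift m f
         - smult (smult (of_int m) [:- (of_int m * \<alpha>), 1:]) (deriv_x (s_shift m f)))"
      unfolding Lp
      by (rule poly_eqI)
        (simp add: cscale_def coeff_pCons algebra_simps smult_diff_right split: nat.split)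
    finally show ?thesis .
  qed
  have G_Q': "gen (G m) (Q f) = P (cscale (l powi m) (smult [:- (2 * of_int m * \<alpha>), 1:] (s_shift m f)))" for m f
  proof -
    have "2 * a m - X * g m = cscale (l powi m) [:[:- (2 * of_int m * \<alpha>), 1:]:]"
      using g_eq_power[OF assms(1) a, of m] by (simp add: a cscale_def numeral_poly mult_ac)
    then show ?thesis by (simp add: G_Q cscale_def)
  qed
  show ?thesis
    by (cases x) (simp_all add: w \<Psi>_def gen_add C1_zero C2_zero P_0 Q_0
        W_P W_Q W L_P Lp L_Q G_P' G_Q' add.commute)
qed

lemma pair_scale_vector_space: "vector_space pair_scale"
  by unfold_locales
    (auto simp: pair_scale_def cscale_def smult_add_right prod_eq_iff smult_add_left[symmetric] mult.commute pCons_one)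

theorem iso_omega: "\<exists>l \<alpha> h. l \<noteq> 0 \<and> module_iso V (omega l \<alpha> h)"
proof -
  obtain l \<alpha> h where l: "l \<noteq> 0"
    and a: "\<And>m. a m = cscale (l powi m) [:[:- (of_int m * \<alpha>), 1:]:]"
    and b: "\<And>m. b m = cscale (l powi m) [:h_sub \<alpha> h m, 1:]"
    using sc.structure_constants_eq by blast
  define \<phi> where "\<phi> = inv \<Psi>"
  have \<phi>\<Psi>: "\<phi> (\<Psi> w) = w" and \<Psi>\<phi>: "\<Psi> (\<phi> u) = u" for u w
    using \<Psi>_bij by (simp_all add: \<phi>_def bij_is_inj bij_is_surj surj_f_inv_f)
  have "module_hom (scal V) pair_scale \<phi>"
  proof -
    interpret pair: vector_space pair_scale by (rule pair_scale_vector_space)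
    show ?thesis
      by unfold_locales (metis \<phi>\<Psi> \<Psi>\<phi> \<Psi>_add, metis \<phi>\<Psi> \<Psi>\<phi> \<Psi>_scale)
  qed
  then have "Vector_Spaces.linear (scal V) pair_scale \<phi>"
    using vs.vector_space_axioms pair_scale_vector_space by (simp add: Vector_Spaces.linear_def)
  moreover have "bij \<phi>"
    unfolding \<phi>_def by (rule bij_imp_bij_inv[OF \<Psi>_bij])
  moreover have "\<phi> ` part V p = part (omega l \<alpha> h) p" for p
    unfolding \<Psi>_part[of l \<alpha> h p, symmetric] by (simp add: image_image \<phi>\<Psi>)
  moreover have "\<phi> (act V x u) = act (omega l \<alpha> h) x (\<phi> u)" for x u
  proof -
    have "\<Psi> (act (omega l \<alpha> h) x (\<phi> u)) = act V x u"
      by (simp add: omega_def \<Psi>_sum \<Psi>_scale \<Psi>_gen[OF l a b] \<Psi>\<phi> act_eq_sum[of x u])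
    then show ?thesis by (metis \<phi>\<Psi>)
  qed
  moreover have "scal (omega l \<alpha> h) = pair_scale"
    by (simp add: omega_def)
  ultimately have "module_iso V (omega l \<alpha> h)"
    unfolding module_iso_def by (intro exI[of _ \<phi>]) simp
  then show ?thesis using l by blast
qed

end

section \<open>Parity change and the classification\<close>

lemma is_super_space_parity_change:
  assumes "is_super_space V" shows "is_super_space (parity_change V)"
proof -
  have "\<exists>a\<in>part V True. \<exists>b\<in>part V False. u = a + b" for u
    using assms unfolding is_super_space_def by (metis add.commute)
  then show ?thesis
    using assms by (simp add: is_super_space_def parity_change_def Int_commute)
qed

lemma is_super_module_parity_change:
  assumes "is_super_module g V" shows "is_super_module g (parity_change V)"
proof -
  have V: "is_super_space V"
    "\<And>v. Vector_Spaces.linear (scal g) (scal V) (\<lambda>x. act V x v)"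
    "\<And>x. Vector_Spaces.linear (scal V) (scal V) (act V x)"
    "\<And>p q x v. x \<in> part g p \<Longrightarrow> v \<in> part V q \<Longrightarrow> act V x v \<in> part V (p \<noteq> q)"
    "\<And>p q x y v. x \<in> part g p \<Longrightarrow> y \<in> part g q \<Longrightarrow>
        act V x (act V y v) - scal V (koszul_sign p q) (act V y (act V x v)) = act V (bracket g x y) v"
    using assms unfolding is_super_module_def by blast+
  have eq: "scal (parity_change V) = scal V" "act (parity_change V) = act V"
    "part (parity_change V) = (\<lambda>p. part V (\<not> p))"
    by (simp_all add: parity_change_def)
  have parity: "act V x v \<in> part V (\<not> (p \<noteq> q))" if "x \<in> part g p" "v \<in> part V (\<not> q)" for p q x v
  proof -
    have "(p \<noteq> (\<not> q)) = (\<not> (p \<noteq> q))" by blast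
    then show ?thesis using V(4)[OF that] by (simp only:)
  qed
  show ?thesis
    unfolding is_super_module_def eq
    by (intro conjI allI ballI V(2,3,5) parity is_super_space_parity_change[OF V(1)])
qed

theorem theorem3p4:
  fixes V :: "(bms, 'v::ab_group_add) super_module"
  assumes "is_super_module ramond_bms V"
    and "free_rank_one_t V"
  shows "\<exists>l \<alpha> :: complex. \<exists>h :: complex poly. l \<noteq> 0 \<and>
           (module_iso V (omega l \<alpha> h) \<or> module_iso (parity_change V) (omega l \<alpha> h))"
proof -
  obtain v p where p: "v \<in> part V p"
    and free: "\<And>u. \<exists>!(f, g). u = poly2_act V f v + gen_act V (G 0) (poly2_act V g v)"
    using assms(2) unfolding free_rank_one_t_def by blast
  show ?thesis
  proof (cases p)
    case False
    interpret ramond_module_generated V v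
    proof unfold_locales
      show "is_super_module ramond_bms V" by (rule assms(1))
      show "v \<in> part V False" using p False by simp
      show "\<exists>!(f, g). u = poly2_act V f v + gen_act V (G 0) (poly2_act V g v)" for u
        by (rule free)
    qed
    show ?thesis using iso_omega by blast
  next
    case True
    have eq: "poly2_act (parity_change V) = poly2_act V" "act (parity_change V) = act V"
      by (simp_all add: fun_eq_iff poly2_act_def parity_change_def)
    interpret ramond_module_generated "parity_change V" v
    proof unfold_locales
      show "is_super_module ramond_bms (parity_change V)"
        by (rule is_super_module_parity_change[OF assms(1)])
      show "v \<in> part (parity_change V) False"
        using p True by (simp add: parity_change_def)
      show "\<exists>!(f, g). u = poly2_act (parity_change V) f v
          + gen_act (parity_change V) (G 0) (poly2_act (parity_change V) g v)" for u
        unfolding eq by (rule free)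
    qed
    show ?thesis using iso_omega by blast
  qed
qed

end
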